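(* Let $G$ be a finite simple undirected graph with vertex set $[n]=\{1,\dots,n\}$. The edge ideal $I(G)=\langle x_ix_j \mid \{i,j\}\in E(G)\rangle\subset \mathbb{K}[x_1,\dots,x_n]$ is $1$-differentially perfect if and only if the graph $G$ is perfect. That is, $G$ is perfect if and only if for all integers $s\ge 1$ $$I(G)^{(s)} = I(G)^{\{s\}}+\sum_{i=1}^{s-1} I(G)^{(i)}\,I(G)^{(s-i)}.$$
   Context: $\mathbb{K}$ is an algebraically closed field and $R=\mathbb{K}[\mathbf{x}]=\mathbb{K}[x_1,\dots,x_n]$. Symbolic power: for an ideal $I\subset R$, $I^{(r)}=(R_I^{-1}I^r)\cap R$, where $R_I$ is the complement of the union of the minimal primes of $I$ (i.e. $f\in I^{(r)}$ iff $gf\in I^r$ for some $g$ lying in no minimal prime of $I$). Join and secant ideals: for ideals $I,J\subset R$, $I\ast J=\big(I(\mathbf{y})+J(\mathbf{z})+\langle x_i-y_i-z_i\mid i=1,\dots,n\rangle\big)\cap\mathbb{K}[\mathbf{x}]$, where $I(\mathbf{y})$ is $I$ with $y_i$ substituted for $x_i$, and the sum is taken in $\mathbb{K}[\mathbf{x},\mathbf{y},\mathbf{z}]$. The $r$-th secant ideal is the $r$-fold join $I^{\{r\}}=I\ast I\ast\cdots\ast I$ (so $I^{\{1\}}=I$). An ideal $I$ is $r$-differentially perfect if for all $s\ge1$, $(I^{\{r\}})^{(s)}=I^{\{r+s-1\}}+\sum_{i=1}^{s-1}(I^{\{r\}})^{(i)}(I^{\{r\}})^{(s-i)}$. A graph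 $G$ is perfect if $\omega(G_V)=\chi(G_V)$ for every $V\subseteq[n]$, where $G_V$ is the induced subgraph on $V$, $\omega$ is the clique number and $\chi$ the chromatic number. *)

theory Defs
  imports
    "HOL-Computational_Algebra.Polynomial"
    "HOL-Library.Poly_Mapping"
    "HOL-Library.Set_Algebras"
    "HOL-Library.Ramsey"
begin

text \<open>Finitely supported maps from exponent vectors to coefficients; \<open>*\<close> is convolution.\<close>

type_synonym ('v, 'k) mpoly = "('v \<Rightarrow>\<^sub>0 nat) \<Rightarrow>\<^sub>0 'k"

definition Const :: "'k::comm_ring_1 \<Rightarrow> ('v, 'k) mpoly"
  where "Const c = Poly_Mapping.single 0 c"

definition Var :: "'v \<Rightarrow> ('v, 'k::comm_ring_1) mpoly"
  where "Var i = Poly_Mapping.single (Poly_Mapping.single i 1) 1"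

definition rename :: "('v \<Rightarrow> 'w) \<Rightarrow> ('v, 'k::comm_ring_1) mpoly \<Rightarrow> ('w, 'k) mpoly"
  where "rename f p =
    (\<Sum>m\<in>Poly_Mapping.keys p. Const (Poly_Mapping.lookup p m) *
       (\<Prod>i\<in>Poly_Mapping.keys m. Var (f i) ^ Poly_Mapping.lookup m i))"


text \<open>
  Ideals are the submodules of the ring regarded as a module over itself. The sum \<open>I + J\<close> of two
  ideals is the elementwise sum of sets, and a finite sum of ideals is \<^const>\<open>sum\<close> in the
  commutative monoid of sets, whose neutral element is the zero ideal. The elementwise product
  \<open>I * J\<close> of sets, and with it \<open>I ^ r\<close>, is not the product of ideals; hence \<open>ideal_prod\<close> and
  \<open>ideal_power\<close>.
\<close>

lemma module_times: "module ((*) :: 'a::comm_ring_1 \<Rightarrow> 'a \<Rightarrow> 'a)"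
  by unfold_locales (simp_all add: algebra_simps)

abbreviation is_ideal :: "'a::comm_ring_1 set \<Rightarrow> bool"
  where "is_ideal \<equiv> module.subspace (*)"

abbreviation ideal_gen :: "'a::comm_ring_1 set \<Rightarrow> 'a set"
  where "ideal_gen \<equiv> module.span (*)"

definition ideal_prod :: "'a::comm_ring_1 set \<Rightarrow> 'a set \<Rightarrow> 'a set"
  where "ideal_prod I J = ideal_gen {a * b |a b. a \<in> I \<and> b \<in> J}"

primrec ideal_power :: "'a::comm_ring_1 set \<Rightarrow> nat \<Rightarrow> 'a set"
  where
    "ideal_power I 0 = UNIV"
  | "ideal_power I (Suc r) = ideal_prod I (ideal_power I r)"

definition prime_ideal :: "'a::comm_ring_1 set \<Rightarrow> bool"
  where "prime_ideal P \<longleftrightarrow>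
    is_ideal P \<and> P \<noteq> UNIV \<and> (\<forall>a b. a * b \<in> P \<longrightarrow> a \<in> P \<or> b \<in> P)"

definition minimal_primes :: "'a::comm_ring_1 set \<Rightarrow> 'a set set"
  where "minimal_primes I =
    {P. prime_ideal P \<and> I \<subseteq> P \<and> (\<forall>Q. prime_ideal Q \<longrightarrow> I \<subseteq> Q \<longrightarrow> Q \<subseteq> P \<longrightarrow> Q = P)}"

definition symbolic_power :: "'a::comm_ring_1 set \<Rightarrow> nat \<Rightarrow> 'a set"
  where "symbolic_power I r = {f. \<exists>g. g \<notin> \<Union> (minimal_primes I) \<and> g * f \<in> ideal_power I r}"


text \<open>The variables of \<open>K[x, y, z]\<close>: three disjoint copies of the variables of \<open>K[x]\<close>.\<close>

datatype 'v xyz = X 'v | Y 'v | Z 'v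

text \<open>The intersection with \<open>K[x]\<close> is the preimage under the embedding \<open>rename X\<close>.\<close>

definition join_ideal ::
    "('v, 'k::comm_ring_1) mpoly set \<Rightarrow> ('v, 'k) mpoly set \<Rightarrow> ('v, 'k) mpoly set"
  where "join_ideal I J =
    {p. rename X p \<in> ideal_gen (rename Y ` I) + ideal_gen (rename Z ` J)
                     + ideal_gen {Var (X i) - Var (Y i) - Var (Z i) |i. True}}"

text \<open>The \<open>r\<close>-fold join, meaningful for \<open>r \<ge> 1\<close>; the value at \<open>0\<close> is a dummy.\<close>

definition secant_ideal :: "('v, 'k::comm_ring_1) mpoly set \<Rightarrow> nat \<Rightarrow> ('v, 'k) mpoly set"
  where "secant_ideal I r = ((\<lambda>J. join_ideal J I) ^^ (r - 1)) I"

definition differentially_perfect :: "nat \<Rightarrow> ('v, 'k::comm_ring_1) mpoly set \<Rightarrow> bool"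
  where "differentially_perfect r I \<longleftrightarrow>
    (\<forall>s\<ge>1. symbolic_power (secant_ideal I r) s =
       secant_ideal I (r + s - 1) +
       (\<Sum>i=1..s - 1. ideal_prod (symbolic_power (secant_ideal I r) i)
                                 (symbolic_power (secant_ideal I r) (s - i))))"


text \<open>
  A finite simple graph is given by a finite vertex set \<open>V\<close> and an edge set \<open>E \<subseteq> [V]\<^bsup>2\<^esup>\<close>.
\<close>

definition induced_edges :: "'v set \<Rightarrow> 'v set set \<Rightarrow> 'v set set"
  where "induced_edges W E = {e \<in> E. e \<subseteq> W}"

definition clique_number :: "'v set \<Rightarrow> 'v set set \<Rightarrow> nat"
  where "clique_number V E = Max {card C |C. C \<subseteq> V \<and> clique C E}"

definition proper_colouring :: "'v set \<Rightarrow> 'v set set \<Rightarrow> ('v \<Rightarrow> nat) \<Rightarrow> bool"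
  where "proper_colouring V E c \<longleftrightarrow> (\<forall>u\<in>V. \<forall>v\<in>V. {u, v} \<in> E \<longrightarrow> c u \<noteq> c v)"

definition chromatic_number :: "'v set \<Rightarrow> 'v set set \<Rightarrow> nat"
  where "chromatic_number V E = (LEAST k. \<exists>c. c ` V \<subseteq> {..<k} \<and> proper_colouring V E c)"

definition perfect_graph :: "'v set \<Rightarrow> 'v set set \<Rightarrow> bool"
  where "perfect_graph V E \<longleftrightarrow>
    (\<forall>W\<subseteq>V. clique_number W (induced_edges W E) = chromatic_number W (induced_edges W E))"

definition edge_ideal :: "'v set set \<Rightarrow> ('v, 'k::comm_ring_1) mpoly set"
  where "edge_ideal E = ideal_gen {Var i * Var j |i j. {i, j} \<in> E}"

end

(*
  All ideals involved are spanned by monomials, so the identity becomes one between sets of exponent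
  vectors w. Such a vector belongs to the s-th symbolic power iff w(V - S) >= s for all stable sets S,
  and to the s-th secant ideal iff its support is not a union of s stable sets.

  If G is perfect, Lovasz's theorem for weighted graphs gives a clique of size c in the support of w
  that meets all stable sets of maximum weight. Subtracting it lowers the minimum of w(V - S) by c - 1
  only, and w splits off a factor in the (c - 1)-st symbolic power, or c > s and the support of w needs
  more than s colours. Conversely, repeatedly decomposing the indicator of a minimal imperfect
  vertex set W yields a cover of W by alpha(W) cliques, unless W is the union of a clique and a
  stable set. Split graphs are perfect, and in the other case W is perfect by duality.
*)

theory Submission
  imports Defs
begin

section \<open>Covers by members of a set system\<close>

text \<open>For a vector w of total weight n, let s be the least w(V - S). Then n - s is the largest
  weight of a stable set, hence a lower bound for the number of cliques that cover w. A clique of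
  size c has order c - 1 and contributes exactly 1 to such a difference; this explains the constant
  c - 1 and lets clique covers add up along decompositions. In the converse, minimality of W gives
  perfection only on smaller supports. The indicator of W escapes the recursion only if it lies in
  the secant ideal, and this one case forces the clique and the stable set.

  Covers use an arbitrary set system because Lovasz's argument is needed twice, the second time with
  the roles of cliques and stable sets exchanged.

  On the algebraic side, the multiplier in a symbolic power is an arbitrary polynomial. That the
  symbolic power is spanned by monomials rests on terms of lowest degree in the variables outside a
  stable set; these lowest degrees add up because the coefficients lie in a domain.\<close>

definition coverable :: "'v set set \<Rightarrow> nat \<Rightarrow> ('v \<Rightarrow> nat) \<Rightarrow> bool"
  where "coverable H k w \<longleftrightarrow>
    (\<exists>S. (\<forall>j<k. S j \<in> H) \<and> (\<forall>v. w v \<le> (\<Sum>j<k. of_bool (v \<in> S j))))"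

lemma coverable_antimono:
  assumes "coverable H k w" "\<And>v. u v \<le> w v"
  shows "coverable H k u"
  using assms unfolding coverable_def by (meson le_trans)

lemma coverable_mono:
  assumes "coverable H k w" "k \<le> l" "{} \<in> H"
  shows "coverable H l w"
proof -
  obtain S where S: "\<forall>j<k. S j \<in> H" "\<forall>v. w v \<le> (\<Sum>j<k. of_bool (v \<in> S j))"
    using assms(1) unfolding coverable_def by blast
  define S' where "S' j = (if j < k then S j else {})" for j
  have "w v \<le> (\<Sum>j<l. of_bool (v \<in> S' j))" for v
  proof -
    have "w v \<le> (\<Sum>j<k. of_bool (v \<in> S' j))"
      using S(2) by (simp add: S'_def)
    also have "\<dots> \<le> (\<Sum>j<l. of_bool (v \<in> S' j))"
      using assms(2) by (intro sum_mono2) auto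
    finally show ?thesis .
  qed
  then show ?thesis
    unfolding coverable_def using S(1) assms(3) by (intro exI[of _ S']) (auto simp: S'_def)
qed

lemma coverable_Suc:
  assumes "coverable H k w" "T \<in> H" "\<And>v. u v \<le> w v + of_bool (v \<in> T)"
  shows "coverable H (Suc k) u"
proof -
  obtain S where S: "\<forall>j<k. S j \<in> H" "\<forall>v. w v \<le> (\<Sum>j<k. of_bool (v \<in> S j))"
    using assms(1) unfolding coverable_def by blast
  have "u v \<le> (\<Sum>j<Suc k. of_bool (v \<in> (S(k := T)) j))" for v
    using S(2)[rule_format, of v] assms(3)[of v] by simp
  then show ?thesis
    unfolding coverable_def using S(1) assms(2)
    by (intro exI[of _ "S(k := T)"]) (auto simp: less_Suc_eq)
qed

lemma coverable_0: "coverable H 0 (\<lambda>v. 0)"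
  by (simp add: coverable_def)

lemma coverable_add:
  assumes "coverable H k w" "coverable H l u"
  shows "coverable H (k + l) (\<lambda>v. w v + u v)"
proof -
  obtain S where S: "\<forall>j<l. S j \<in> H" "\<forall>v. u v \<le> (\<Sum>j<l. of_bool (v \<in> S j))"
    using assms(2) unfolding coverable_def by blast
  have "i \<le> l \<Longrightarrow> coverable H (k + i) (\<lambda>v. w v + (\<Sum>j<i. of_bool (v \<in> S j)))" for i
  proof (induction i)
    case 0
    then show ?case using assms(1) by simp
  next
    case (Suc i)
    then show ?case
      using S(1) coverable_Suc[of H "k + i" "\<lambda>v. w v + (\<Sum>j<i. of_bool (v \<in> S j))" "S i"] by simp
  qed
  from this[of l] show ?thesis
    by (rule coverable_antimono) (use S(2) in auto)
qed

lemma coverable_of_bool_1: "T \<in> H \<Longrightarrow> coverable H 1 (\<lambda>v. of_bool (v \<in> T))"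
  using coverable_Suc[OF coverable_0] by fastforce

lemma coverable_singletons:
  fixes w :: "'v::finite \<Rightarrow> nat"
  assumes "\<And>v. {v} \<in> H"
  shows "coverable H (sum w UNIV) w"
proof (induction "sum w UNIV" arbitrary: w)
  case 0
  then have "w = (\<lambda>v. 0)" by (simp add: fun_eq_iff)
  then show ?case by (simp add: coverable_0)
next
  case (Suc n)
  then obtain v where v: "w v > 0"
    by (metis gr0I sum.neutral nat.distinct(1))
  define u where "u = w(v := w v - 1)"
  have "sum w UNIV = w v + sum w (UNIV - {v})" "sum u UNIV = u v + sum u (UNIV - {v})"
    by (simp_all add: sum.remove)
  moreover have "sum u (UNIV - {v}) = sum w (UNIV - {v})"
    by (intro sum.cong) (auto simp: u_def)
  ultimately have "sum u UNIV = n"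
    using Suc(2) v by (simp add: u_def)
  with Suc(1)[of u] have "coverable H n u" by simp
  then have "coverable H (Suc n) w"
    by (rule coverable_Suc[OF _ assms[of v]]) (auto simp: u_def)
  then show ?case using Suc(2) by simp
qed

lemma coverable_UN:
  assumes "finite Q" "\<And>q. q \<in> Q \<Longrightarrow> T q \<in> H"
  shows "coverable H (card Q) (\<lambda>v. of_bool (v \<in> (\<Union>q\<in>Q. T q)))"
  using assms
proof (induction Q rule: finite_induct)
  case empty
  then show ?case by (simp add: coverable_0)
next
  case (insert q Q)
  then have "coverable H (Suc (card Q)) (\<lambda>v. of_bool (v \<in> (\<Union>q\<in>insert q Q. T q)))"
    by (intro coverable_Suc[of H "card Q" "\<lambda>v. of_bool (v \<in> (\<Union>q\<in>Q. T q))" "T q"]) auto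
  then show ?case using insert.hyps by simp
qed

lemma sum_of_bool_mem: "finite K \<Longrightarrow> (\<Sum>v\<in>K. of_bool (v \<in> S)) = card (K \<inter> S)"
  by (simp add: of_bool_def sum.If_cases Int_def)

lemma sum_sum_of_bool:
  fixes K :: "'v::finite set"
  shows "(\<Sum>v\<in>K. \<Sum>j\<in>J. of_bool (v \<in> S j)) = (\<Sum>j\<in>J. card (K \<inter> S j))"
  by (subst sum.swap) (simp add: sum_of_bool_mem)

text \<open>
  With cliques for \<open>F\<close> and stable sets for \<open>H\<close>, every induced subgraph of \<open>W\<close> satisfies \<open>\<chi> = \<omega>\<close>;
  with the roles exchanged, this is perfection of the complement.
\<close>

definition min_max_on :: "'v set set \<Rightarrow> 'v set set \<Rightarrow> 'v set \<Rightarrow> bool"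
  where "min_max_on F H W \<longleftrightarrow>
    (\<forall>U\<subseteq>W. \<forall>k. (\<forall>K\<in>F. K \<subseteq> U \<longrightarrow> card K \<le> k) \<longrightarrow> coverable H k (\<lambda>v. of_bool (v \<in> U)))"

text \<open>Apart from \<open>min_max\<close> the assumptions are symmetric in \<open>F\<close> and
  \<open>H\<close>, so the theory also serves for the complementary graph, which is never
  constructed. Adjacency enters only through \<open>card_Int\<close>.\<close>

locale cross_systems =
  fixes F H :: "'v::finite set set" and W :: "'v set"
  assumes F_subset: "K \<in> F \<Longrightarrow> K' \<subseteq> K \<Longrightarrow> K' \<in> F"
    and H_subset: "S \<in> H \<Longrightarrow> S' \<subseteq> S \<Longrightarrow> S' \<in> H"
    and F_singleton: "{v} \<in> F"
    and H_singleton: "{v} \<in> H"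
    and card_Int: "K \<in> F \<Longrightarrow> S \<in> H \<Longrightarrow> card (K \<inter> S) \<le> 1"
    and min_max: "min_max_on F H W"
begin

lemma coverable_H:
  assumes "U \<subseteq> W" "\<And>K. K \<in> F \<Longrightarrow> K \<subseteq> U \<Longrightarrow> card K \<le> k"
  shows "coverable H k (\<lambda>v. of_bool (v \<in> U))"
  using assms min_max unfolding min_max_on_def by blast

lemma F_empty: "{} \<in> F"
  using F_singleton F_subset by blast

text \<open>Lovasz's replication lemma, with multiplicities in place of copies of vertices.\<close>

lemma weighted_coverable:
  assumes "\<And>v. w v > 0 \<Longrightarrow> v \<in> W" "\<And>K. K \<in> F \<Longrightarrow> sum w K \<le> k"
  shows "coverable H k w"
  using assms
proof (induction "sum w UNIV" arbitrary: w k rule: less_induct)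
  case less
  show ?case
  proof (cases "\<forall>v. w v \<le> 1")
    case True
    define U where "U = {v. w v > 0}"
    have w: "w v = of_bool (v \<in> U)" for v
      using True[rule_format, of v] by (auto simp: U_def)
    have "card K \<le> k" if "K \<in> F" "K \<subseteq> U" for K
    proof -
      have "sum w K = card K"
        using that by (simp add: w sum_of_bool_mem Int_absorb2)
      then show ?thesis using less.prems(2)[OF that(1)] by simp
    qed
    then have "coverable H k (\<lambda>v. of_bool (v \<in> U))"
      using less.prems(1) by (intro coverable_H) (auto simp: U_def)
    then show ?thesis using w by presburger
  next
    case False
    then obtain v where v: "w v \<ge> 2" by (metis not_less_eq_eq numeral_2_eq_2 One_nat_def)
    \<comment> \<open>Lowering a multiplicity of at least 2 keeps \<open>v\<close> in the support,
      so a cover of \<open>w1\<close> has a member \<open>S j0\<close> through \<open>v\<close>.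
      Removing all of \<open>S j0\<close> from \<open>w\<close>, and not only a copy of
      \<open>v\<close>, is what lowers the bound \<open>k\<close>.\<close>
    define w1 where "w1 = w(v := w v - 1)"
    have le: "w1 u \<le> w u" for u by (simp add: w1_def)
    have "sum w1 UNIV < sum w UNIV"
      by (rule sum_strict_mono_ex1) (use v in \<open>auto simp: w1_def intro: exI[of _ v]\<close>)
    moreover have "sum w1 K \<le> k" if "K \<in> F" for K
      using less.prems(2)[OF that] sum_mono[of K w1 w] le by (meson le_trans)
    moreover have "w1 u > 0 \<Longrightarrow> u \<in> W" for u
      using less.prems(1)[of u] le[of u] by linarith
    ultimately have "coverable H k w1"
      using less.hyps by blast
    then obtain S where S: "\<forall>j<k. S j \<in> H" "\<And>u. w1 u \<le> (\<Sum>j<k. of_bool (u \<in> S j))"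
      unfolding coverable_def by blast
    have "(\<Sum>j<k. of_bool (v \<in> S j)) \<noteq> (0 :: nat)"
      using S(2)[of v] v unfolding w1_def by (metis (no_types, lifting) One_nat_def diff_is_0_eq
          fun_upd_same le_zero_eq not_less_eq_eq numeral_2_eq_2)
    then obtain j0 where j0: "j0 < k" "v \<in> S j0" by auto
    define w2 where "w2 u = w u - of_bool (u \<in> S j0)" for u
    have "sum w2 UNIV < sum w UNIV"
      by (rule sum_strict_mono_ex1) (use v j0 in \<open>auto simp: w2_def intro: exI[of _ v]\<close>)
    moreover have "sum w2 K \<le> k - 1" if K: "K \<in> F" for K
    proof (cases "\<exists>u\<in>K. w u > 0 \<and> u \<in> S j0")
      case True
      then have "\<exists>u\<in>K. w2 u < w u" unfolding w2_def
        by (metis diff_less of_bool_eq(2) zero_less_one)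
      then have "sum w2 K < sum w K"
        by (intro sum_strict_mono_ex1) (simp_all add: w2_def)
      with less.prems(2)[OF K] show ?thesis by linarith
    next
      case False
      \<comment> \<open>A \<open>K\<close> that avoids \<open>S j0\<close> on the support of
        \<open>w\<close> does not contain \<open>v\<close>, so \<open>w\<close> and
        \<open>w1\<close> agree on it. Only the \<open>k - 1\<close> other sets cover it there, and
        each meets it at most once.\<close>
      define K0 where "K0 = {u \<in> K. w u > 0}"
      have K0: "K0 \<in> F" by (rule F_subset[OF K]) (simp add: K0_def)
      have "sum w2 K \<le> sum w K" by (intro sum_mono) (simp add: w2_def)
      also have "\<dots> = sum w K0"
        by (rule sum.mono_neutral_right) (auto simp: K0_def)
      also have "\<dots> = sum w1 K0"
        using False j0 v by (intro sum.cong) (auto simp: w1_def K0_def)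
      also have "\<dots> \<le> (\<Sum>u\<in>K0. \<Sum>j<k. of_bool (u \<in> S j))"
        by (intro sum_mono S(2))
      also have "\<dots> = (\<Sum>j<k. card (K0 \<inter> S j))"
        by (rule sum_sum_of_bool)
      also have "\<dots> = (\<Sum>j\<in>{..<k} - {j0}. card (K0 \<inter> S j))"
        using False by (intro sum.mono_neutral_right) (auto simp: K0_def)
      also have "\<dots> \<le> (\<Sum>j\<in>{..<k} - {j0}. 1)"
        using S(1) K0 card_Int by (intro sum_mono) auto
      finally show ?thesis using j0 by simp
    qed
    moreover have "w2 u > 0 \<Longrightarrow> u \<in> W" for u
      using less.prems(1)[of u] by (simp add: w2_def)
    ultimately have "coverable H (k - 1) w2"
      using less.hyps by blast
    then have "coverable H (Suc (k - 1)) w"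
      by (rule coverable_Suc[of _ _ _ "S j0"]) (use S(1) j0 in \<open>auto simp: w2_def\<close>)
    then show ?thesis using j0 by simp
  qed
qed

text \<open>
  If every \<open>K\<close> missed one of the \<open>t\<close> heaviest members of \<open>H\<close>, the sum of these members could be
  covered by \<open>t - 1\<close> members of \<open>H\<close>, one of which would be even heavier.
\<close>

lemma ex_hitting:
  fixes w :: "'v \<Rightarrow> nat"
  assumes w: "\<And>v. w v > 0 \<Longrightarrow> v \<in> W" and a: "\<And>S. S \<in> H \<Longrightarrow> sum w S \<le> a" and "a > 0"
  shows "\<exists>K\<in>F. (\<forall>v\<in>K. w v > 0) \<and> (\<forall>S\<in>H. sum w S = a \<longrightarrow> K \<inter> S \<noteq> {})"
proof (rule ccontr)
  assume neg: "\<not> ?thesis"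
  define M where "M = {S \<in> H. sum w S = a}"
  define P where "P = {v. w v > 0}"
  have miss: "\<exists>S\<in>M. K \<inter> P \<inter> S = {}" if "K \<in> F" for K
  proof -
    have "K \<inter> P \<in> F" using F_subset that by blast
    moreover have "\<forall>v\<in>K \<inter> P. w v > 0" by (simp add: P_def)
    ultimately show ?thesis using neg unfolding M_def by blast
  qed
  define t where "t = card M"
  \<comment> \<open>\<open>u\<close> adds up the heaviest members, cut down to the support of
    \<open>w\<close>. This keeps \<open>u\<close> inside \<open>W\<close>, and as \<open>w\<close>
    vanishes elsewhere it does not change the weighted count below.\<close>
  define u where "u v = (\<Sum>S\<in>M. of_bool (v \<in> P \<inter> S) :: nat)" for v
  have "M \<noteq> {}" using miss F_empty by blast
  then have t: "t > 0" by (simp add: t_def card_gt_0_iff)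
  have "sum u K \<le> t - 1" if K: "K \<in> F" for K
  proof -
    obtain S0 where S0: "S0 \<in> M" "K \<inter> P \<inter> S0 = {}" using miss[OF K] by blast
    have KP: "K \<inter> P \<in> F" using F_subset K by blast
    have "sum u K = (\<Sum>S\<in>M. card (K \<inter> (P \<inter> S)))"
      unfolding u_def by (rule sum_sum_of_bool)
    also have "\<dots> = (\<Sum>S\<in>M - {S0}. card (K \<inter> P \<inter> S))"
      using S0 by (subst sum.mono_neutral_right[of M "M - {S0}"]) (auto simp: Int_assoc)
    also have "\<dots> \<le> (\<Sum>S\<in>M - {S0}. 1)"
      using KP card_Int by (intro sum_mono) (auto simp: M_def)
    finally show ?thesis using S0 by (simp add: t_def)
  qed
  moreover have "u v > 0 \<Longrightarrow> v \<in> W" for v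
  proof -
    assume "u v > 0"
    then have "v \<in> P" by (cases "v \<in> P") (auto simp: u_def)
    then show "v \<in> W" using w by (simp add: P_def)
  qed
  ultimately have "coverable H (t - 1) u"
    by (intro weighted_coverable) auto
  then obtain T where T: "\<And>j. j < t - 1 \<Longrightarrow> T j \<in> H" "\<And>v. u v \<le> (\<Sum>j<t - 1. of_bool (v \<in> T j))"
    unfolding coverable_def by blast
  have weight: "(\<Sum>v\<in>UNIV. w v * of_bool (v \<in> S)) = sum w S" for S
    by (rule sum.mono_neutral_cong_right) auto
  \<comment> \<open>Double counting: the members of \<open>M\<close> weigh \<open>t * a\<close>
    together, but their sum is dominated by \<open>t - 1\<close> members of \<open>H\<close> of
    weight at most \<open>a\<close> each.\<close>
  have "t * a = (\<Sum>S\<in>M. sum w S)"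
    by (simp add: t_def M_def)
  also have "\<dots> = (\<Sum>S\<in>M. \<Sum>v\<in>UNIV. w v * of_bool (v \<in> S))"
    by (simp only: weight)
  also have "\<dots> = (\<Sum>v\<in>UNIV. w v * (\<Sum>S\<in>M. of_bool (v \<in> S)))"
    by (subst sum.swap) (simp only: sum_distrib_left)
  also have "\<dots> = (\<Sum>v\<in>UNIV. w v * u v)"
    by (intro sum.cong refl) (auto simp: u_def P_def)
  also have "\<dots> \<le> (\<Sum>v\<in>UNIV. w v * (\<Sum>j<t - 1. of_bool (v \<in> T j)))"
    by (intro sum_mono mult_left_mono T(2)) auto
  also have "\<dots> = (\<Sum>j<t - 1. \<Sum>v\<in>UNIV. w v * of_bool (v \<in> T j))"
    by (subst sum.swap) (simp only: sum_distrib_left)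
  also have "\<dots> = (\<Sum>j<t - 1. sum w (T j))"
    by (simp only: weight)
  also have "\<dots> \<le> (\<Sum>j<t - 1. a)"
    using T(1) a by (intro sum_mono) auto
  finally have "t * a \<le> (t - 1) * a" by simp
  then show False using t \<open>a > 0\<close> by simp
qed

text \<open>Lovasz's perfect graph theorem, by greedy removal: one member of \<open>F\<close> meets
  all members of \<open>H\<close> that attain the bound inside \<open>U\<close>, and taking it out
  of \<open>U\<close> lowers the bound by one.\<close>

lemma coverable_F:
  assumes "U \<subseteq> W" "\<And>S. S \<in> H \<Longrightarrow> S \<subseteq> U \<Longrightarrow> card S \<le> a"
  shows "coverable F a (\<lambda>v. of_bool (v \<in> U))"
  using assms
proof (induction a arbitrary: U)
  case 0
  have "U = {}"
    using 0(2) H_singleton by fastforce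
  then show ?case using coverable_0[of F] by simp
next
  case (Suc a)
  let ?w = "\<lambda>v. of_bool (v \<in> U) :: nat"
  have wS: "sum ?w S = card (S \<inter> U)" for S by (simp add: sum_of_bool_mem)
  have "sum ?w S \<le> Suc a" if "S \<in> H" for S
    unfolding wS using that H_subset by (intro Suc.prems(2)) auto
  then obtain K where K: "K \<in> F" "\<And>S. S \<in> H \<Longrightarrow> sum ?w S = Suc a \<Longrightarrow> K \<inter> S \<noteq> {}"
    using ex_hitting[of ?w "Suc a"] Suc.prems(1) by fastforce
  have "card S \<le> a" if "S \<in> H" "S \<subseteq> U - K" for S
  proof -
    have "S \<inter> U = S" using that by blast
    then have "card S \<noteq> Suc a"
      using K(2)[OF that(1)] that(2) wS[of S] by auto
    moreover have "card S \<le> Suc a" using Suc.prems(2) that by blast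
    ultimately show ?thesis by simp
  qed
  then have "coverable F a (\<lambda>v. of_bool (v \<in> U - K))"
    using Suc.prems(1) by (intro Suc.IH) auto
  then show ?case
    by (rule coverable_Suc[OF _ K(1)]) auto
qed

lemma min_max_dual: "min_max_on H F W"
  unfolding min_max_on_def using coverable_F by blast

end

section \<open>Stable sets, cliques and perfect graphs\<close>

definition stable_sets :: "'v set set \<Rightarrow> 'v set set"
  where "stable_sets E = {S. \<forall>e\<in>E. \<not> e \<subseteq> S}"

definition cliques :: "'v set set \<Rightarrow> 'v set set"
  where "cliques E = {K. clique K E}"

text \<open>
  The exponent vectors of the monomials in the symbolic power \<open>I\<^bsup>(s)\<^esup>\<close>, where the vertex covers
  are written as complements of stable sets, and in the secant ideal \<open>I\<^bsup>{s}\<^esup>\<close>.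
\<close>

definition symbolic_weights :: "'v set set \<Rightarrow> nat \<Rightarrow> ('v \<Rightarrow> nat) set"
  where "symbolic_weights E s = {w. \<forall>S\<in>stable_sets E. s \<le> sum w (- S)}"

definition secant_weights :: "'v set set \<Rightarrow> nat \<Rightarrow> ('v \<Rightarrow> nat) set"
  where "secant_weights E s = {w. \<not> coverable (stable_sets E) s (\<lambda>v. of_bool (w v > 0))}"

lemma cliques_subset: "K \<in> cliques E \<Longrightarrow> K' \<subseteq> K \<Longrightarrow> K' \<in> cliques E"
  by (auto simp: cliques_def clique_def)

lemma cliques_singleton: "{v} \<in> cliques E"
  by (auto simp: cliques_def clique_def)

lemma stable_sets_subset: "S \<in> stable_sets E \<Longrightarrow> S' \<subseteq> S \<Longrightarrow> S' \<in> stable_sets E"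
  by (auto simp: stable_sets_def)

lemma card_clique_Int_stable:
  fixes K :: "'v::finite set"
  assumes "K \<in> cliques E" "S \<in> stable_sets E"
  shows "card (K \<inter> S) \<le> 1"
proof -
  have "x = y" if "x \<in> K \<inter> S" "y \<in> K \<inter> S" for x y
  proof (rule ccontr)
    assume "x \<noteq> y"
    then have "{x, y} \<in> E" using that assms(1) by (auto simp: cliques_def clique_def)
    moreover have "{x, y} \<subseteq> S" using that by blast
    ultimately show False using assms(2) unfolding stable_sets_def by blast
  qed
  then show ?thesis
    using card_le_Suc0_iff_eq[of "K \<inter> S"] by simp
qed

context
  fixes E :: "'v::finite set set"
  assumes E: "E \<subseteq> [UNIV]\<^bsup>2\<^esup>"
begin

lemma edge_card: "e \<in> E \<Longrightarrow> card e = 2"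
  using E by (auto simp: nsets_def)

lemma stable_sets_singleton: "{v} \<in> stable_sets E"
proof -
  have "\<not> e \<subseteq> {v}" if "e \<in> E" for e
    using edge_card[OF that] card_mono[of "{v}" e] by auto
  then show ?thesis by (simp add: stable_sets_def)
qed

lemma stable_sets_pair: "{x, y} \<notin> E \<Longrightarrow> {x, y} \<in> stable_sets E"
proof -
  assume xy: "{x, y} \<notin> E"
  have "\<not> e \<subseteq> {x, y}" if "e \<in> E" for e
  proof
    assume le: "e \<subseteq> {x, y}"
    have "card {x, y} \<le> 2" by (simp add: card_insert_if)
    then have "e = {x, y}" using le edge_card[OF that]
      by (intro card_subset_eq) (auto intro: antisym card_mono dest: card_mono[rotated])
    then show False using xy that by simp
  qed
  then show ?thesis by (simp add: stable_sets_def)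
qed

lemma stable_sets_empty: "{} \<in> stable_sets E"
  using stable_sets_singleton stable_sets_subset by blast

lemma cliques_empty: "{} \<in> cliques E"
  by (simp add: cliques_def)

lemma cross_systems_graph:
  assumes "min_max_on (cliques E) (stable_sets E) W"
  shows "cross_systems (cliques E) (stable_sets E) W"
  by (rule cross_systems.intro[OF cliques_subset stable_sets_subset cliques_singleton
      stable_sets_singleton card_clique_Int_stable assms])

lemma card_stable_Int_clique:
  "S \<in> stable_sets E \<Longrightarrow> K \<in> cliques E \<Longrightarrow> card (S \<inter> K) \<le> 1"
  using card_clique_Int_stable by (subst Int_commute)

lemma cross_systems_complement:
  assumes "min_max_on (stable_sets E) (cliques E) W"
  shows "cross_systems (stable_sets E) (cliques E) W"
  by (rule cross_systems.intro[OF stable_sets_subset cliques_subset stable_sets_singleton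
      cliques_singleton card_stable_Int_clique assms])

lemma card_clique_le:
  assumes "coverable (stable_sets E) k w" "K \<in> cliques E" "\<And>v. v \<in> K \<Longrightarrow> w v > 0"
  shows "card K \<le> k"
proof -
  obtain S where S: "\<And>j. j < k \<Longrightarrow> S j \<in> stable_sets E" "\<And>v. w v \<le> (\<Sum>j<k. of_bool (v \<in> S j))"
    using assms(1) unfolding coverable_def by blast
  have "card K = (\<Sum>v\<in>K. 1)" by simp
  also have "\<dots> \<le> (\<Sum>v\<in>K. \<Sum>j<k. of_bool (v \<in> S j))"
  proof (rule sum_mono)
    fix v assume "v \<in> K"
    then show "1 \<le> (\<Sum>j<k. of_bool (v \<in> S j) :: nat)"
      using assms(3)[of v] S(2)[of v] by linarith
  qed
  also have "\<dots> = (\<Sum>j<k. card (K \<inter> S j))"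
    by (rule sum_sum_of_bool)
  also have "\<dots> \<le> (\<Sum>j<k. 1)"
    using S(1) assms(2) card_clique_Int_stable by (intro sum_mono) auto
  finally show ?thesis by simp
qed

text \<open>If a stable set \<open>S\<close> leaves weight less than \<open>s\<close> outside, then
  \<open>S\<close> serves as one colour class and each vertex of the support outside
  \<open>S\<close> as a class of its own, which makes at most \<open>s\<close> classes.\<close>

lemma secant_weights_subset: "secant_weights E s \<subseteq> symbolic_weights E s"
proof
  fix w assume w: "w \<in> secant_weights E s"
  show "w \<in> symbolic_weights E s"
  proof (rule ccontr)
    assume "w \<notin> symbolic_weights E s"
    then obtain S where S: "S \<in> stable_sets E" "sum w (- S) < s"
      by (auto simp: symbolic_weights_def not_le)
    define u where "u v = (of_bool (w v > 0 \<and> v \<notin> S) :: nat)" for v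
    have "sum u UNIV \<le> sum w (- S)"
    proof -
      have "sum u UNIV = sum u (- S)"
        by (rule sum.mono_neutral_right) (auto simp: u_def)
      also have "\<dots> \<le> sum w (- S)"
        by (rule sum_mono) (auto simp: u_def)
      finally show ?thesis .
    qed
    then have "sum u UNIV \<le> s - 1" using S(2) by linarith
    with coverable_singletons[OF stable_sets_singleton, of u]
    have "coverable (stable_sets E) (s - 1) u"
      using coverable_mono stable_sets_empty by blast
    then have "coverable (stable_sets E) (Suc (s - 1)) (\<lambda>v. of_bool (w v > 0))"
      by (rule coverable_Suc[OF _ S(1)]) (auto simp: u_def)
    then show False using w S(2) by (simp add: secant_weights_def)
  qed
qed

section \<open>Decomposing symbolic weights of a perfect graph\<close>

lemma symbolic_weights_add:
  assumes "a \<in> symbolic_weights E i" "b \<in> symbolic_weights E j"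
  shows "(\<lambda>v. a v + b v) \<in> symbolic_weights E (i + j)"
  using assms by (auto simp: symbolic_weights_def sum.distrib intro: add_mono)

lemma symbolic_weights_mono:
  assumes "a \<in> symbolic_weights E i" "\<And>v. a v \<le> b v"
  shows "b \<in> symbolic_weights E i"
proof -
  have "sum a (- S) \<le> sum b (- S)" for S
    using assms(2) by (rule sum_mono)
  with assms(1) show ?thesis unfolding symbolic_weights_def by (auto intro: le_trans)
qed

lemma secant_weights_mono:
  assumes "a \<in> secant_weights E i" "\<And>v. a v \<le> b v"
  shows "b \<in> secant_weights E i"
proof -
  have le: "of_bool (a v > 0) \<le> (of_bool (b v > 0) :: nat)" for v
    using assms(2)[of v] by (auto simp: order.strict_trans2)
  have "coverable (stable_sets E) i (\<lambda>v. of_bool (a v > 0))"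
    if "coverable (stable_sets E) i (\<lambda>v. of_bool (b v > 0))"
    using that le by (rule coverable_antimono)
  with assms(1) show ?thesis unfolding secant_weights_def by blast
qed

text \<open>
  Subtracting a clique of size \<open>c\<close> that meets all stable sets of maximum weight lowers
  \<open>Min\<^sub>S w(- S)\<close> by \<open>c - 1\<close> only.
\<close>

lemma symbolic_weights_decompose:
  assumes perf: "min_max_on (cliques E) (stable_sets E) UNIV"
    and "w \<in> symbolic_weights E s" "s \<ge> 1"
  shows "w \<in> secant_weights E s \<or>
    (\<exists>i\<in>{1..s - 1}. \<exists>a\<in>symbolic_weights E i. \<exists>b\<in>symbolic_weights E (s - i). w = (\<lambda>v. a v + b v))"
  using assms(2)
proof (induction "sum w UNIV" arbitrary: w rule: less_induct)
  case less
  interpret cross_systems "cliques E" "stable_sets E" UNIV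
    using cross_systems_graph[OF perf] .
  define \<alpha> where "\<alpha> = Max (sum w ` stable_sets E)"
  have "\<alpha> \<in> sum w ` stable_sets E"
    unfolding \<alpha>_def using stable_sets_empty by (intro Max_in) auto
  then obtain S0 where S0: "S0 \<in> stable_sets E" "sum w S0 = \<alpha>" by auto
  have \<alpha>: "sum w S \<le> \<alpha>" if "S \<in> stable_sets E" for S
    unfolding \<alpha>_def using that by (intro Max_ge) auto
  have "sum w UNIV \<ge> s"
    using less.prems stable_sets_empty unfolding symbolic_weights_def
    by (metis (no_types, lifting) Compl_empty_eq mem_Collect_eq)
  then have "sum w UNIV \<noteq> 0" using assms(3) by linarith
  then obtain v0 where "w v0 > 0" by (auto simp: neq0_conv)
  then have "\<alpha> > 0" using \<alpha>[OF stable_sets_singleton[of v0]] by simp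
  then obtain K where K: "K \<in> cliques E" "\<And>v. v \<in> K \<Longrightarrow> w v > 0"
      "\<And>S. S \<in> stable_sets E \<Longrightarrow> sum w S = \<alpha> \<Longrightarrow> K \<inter> S \<noteq> {}"
    using ex_hitting[of w \<alpha>] \<alpha> by blast
  define c where "c = card K"
  have "K \<noteq> {}" using K(3)[OF S0] by blast
  then have c: "c \<ge> 1" by (simp add: c_def Suc_le_eq card_gt_0_iff)
  define u where "u v = w v - of_bool (v \<in> K)" for v
  have w: "w v = of_bool (v \<in> K) + u v" for v
    using K(2)[of v] by (auto simp: u_def)
  have sum_w: "sum w A = card (A \<inter> K) + sum u A" for A
    by (simp add: w sum.distrib sum_of_bool_mem)
  \<comment> \<open>The total weight falls by \<open>c\<close>, but the largest stable weight falls
    too: the heaviest stable sets lose a vertex to \<open>K\<close>, and the others were lighter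
    already. This is the origin of the summand 1.\<close>
  have u: "s + 1 \<le> sum u (- S) + c" if S: "S \<in> stable_sets E" for S
  proof -
    have "sum u S < \<alpha>"
    proof (cases "sum w S = \<alpha>")
      case True
      then have "card (S \<inter> K) > 0" using K(3)[OF S] by (simp add: card_gt_0_iff Int_commute)
      then show ?thesis using True sum_w[of S] by linarith
    next
      case False
      then show ?thesis using \<alpha>[OF S] sum_w[of S] by linarith
    qed
    moreover have "sum f UNIV = sum f T + sum f (- T)" for f :: "'v \<Rightarrow> nat" and T
      by (metis Compl_eq_Diff_UNIV add.commute finite sum.subset_diff top_greatest)
    note this[of u S] this[of w S0]
    moreover have "s \<le> sum w (- S0)"
      using less.prems S0(1) by (auto simp: symbolic_weights_def)
    ultimately show ?thesis
      using sum_w[of UNIV] S0(2) by (simp add: c_def)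
  qed
  have clique_weight: "(\<lambda>v. of_bool (v \<in> K)) \<in> symbolic_weights E (c - 1)"
  proof -
    have "c - 1 \<le> card (- S \<inter> K)" if "S \<in> stable_sets E" for S
    proof -
      have "- S \<inter> K = K - K \<inter> S" by blast
      then have "card (- S \<inter> K) = c - card (K \<inter> S)"
        by (simp add: c_def card_Diff_subset)
      then show ?thesis using card_Int[OF K(1) that] by simp
    qed
    then show ?thesis
      by (simp add: symbolic_weights_def sum_of_bool_mem)
  qed
  consider "c = 1" | "c \<ge> s + 1" | "2 \<le> c" "c \<le> s" using c by linarith
  then show ?case
  proof cases
    \<comment> \<open>A single vertex has order 0 and is not an admissible factor. It is set aside
      and afterwards added back to \<open>a\<close> or to the secant weight; this is the case that
      needs induction on the total weight.\<close>
    case 1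
    have us: "u \<in> symbolic_weights E s"
      using u 1 by (auto simp: symbolic_weights_def)
    have "sum u UNIV < sum w UNIV"
      using sum_w[of UNIV] c by (simp add: c_def)
    from less.hyps[OF this us] show ?thesis
    proof
      assume "u \<in> secant_weights E s"
      then show ?thesis using w by (auto elim!: secant_weights_mono)
    next
      assume "\<exists>i\<in>{1..s - 1}. \<exists>a\<in>symbolic_weights E i. \<exists>b\<in>symbolic_weights E (s - i). u = (\<lambda>v. a v + b v)"
      then obtain i a b where i: "i \<in> {1..s - 1}" and ab: "a \<in> symbolic_weights E i"
        "b \<in> symbolic_weights E (s - i)" "u = (\<lambda>v. a v + b v)" by blast
      have "(\<lambda>v. of_bool (v \<in> K) + a v) \<in> symbolic_weights E i"
        by (rule symbolic_weights_mono[OF ab(1)]) simp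
      moreover have "w = (\<lambda>v. (of_bool (v \<in> K) + a v) + b v)"
        using w ab(3) by (simp add: fun_eq_iff)
      ultimately show ?thesis using i ab(2)
        by (intro disjI2 bexI[of _ i] bexI[of _ "\<lambda>v. of_bool (v \<in> K) + a v"] bexI[of _ b])
    qed
  next
    case 2
    have "\<not> coverable (stable_sets E) s (\<lambda>v. of_bool (w v > 0))"
      using card_clique_le[OF _ K(1), of s "\<lambda>v. of_bool (w v > 0)"] K(2) 2 by (auto simp: c_def)
    then show ?thesis by (simp add: secant_weights_def)
  next
    case 3
    have "s - (c - 1) \<le> sum u (- S)" if "S \<in> stable_sets E" for S
      using u[OF that] by linarith
    then have "u \<in> symbolic_weights E (s - (c - 1))"
      by (auto simp: symbolic_weights_def)
    moreover have "w = (\<lambda>v. of_bool (v \<in> K) + u v)" using w by blast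
    moreover have "c - 1 \<in> {1..s - 1}" using 3 by auto
    ultimately show ?thesis using clique_weight
      by (intro disjI2 bexI[of _ "c - 1"] bexI[of _ "\<lambda>v. of_bool (v \<in> K)"] bexI[of _ u])
  qed
qed

section \<open>Perfection from decompositions\<close>

text \<open>The number \<open>sum w UNIV - s\<close> is additive along decompositions, so only
  secant weights remain. Their support needs more than \<open>s\<close> colours and is a proper
  subset of \<open>W\<close>, where \<open>perf\<close> provides a clique with more than
  \<open>s\<close> vertices. This clique, and singletons for the rest of \<open>w\<close>, are few
  enough cliques.\<close>

lemma clique_cover_of_symbolic_weight:
  assumes dec: "\<And>s w. s \<ge> 1 \<Longrightarrow> w \<in> symbolic_weights E s \<Longrightarrow> w \<in> secant_weights E s \<or>
      (\<exists>i\<in>{1..s - 1}. \<exists>a\<in>symbolic_weights E i. \<exists>b\<in>symbolic_weights E (s - i). w = (\<lambda>v. a v + b v))"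
    and perf: "\<And>U. U \<subset> W \<Longrightarrow> min_max_on (cliques E) (stable_sets E) U"
    and "s \<ge> 1" "w \<in> symbolic_weights E s" "{v. w v > 0} \<subset> W"
  shows "s \<le> sum w UNIV \<and> coverable (cliques E) (sum w UNIV - s) w"
  using assms(3-)
proof (induction s arbitrary: w rule: less_induct)
  case (less s)
  consider "w \<in> secant_weights E s" | i a b where "i \<in> {1..s - 1}" "a \<in> symbolic_weights E i"
      "b \<in> symbolic_weights E (s - i)" "w = (\<lambda>v. a v + b v)"
    using dec[OF less.prems(1,2)] by blast
  then show ?case
  proof cases
    case 1
    define U where "U = {v. w v > 0}"
    have "\<not> coverable (stable_sets E) s (\<lambda>v. of_bool (v \<in> U))"
      using 1 by (simp add: secant_weights_def U_def)
    then obtain K where K: "K \<in> cliques E" "K \<subseteq> U" "\<not> card K \<le> s"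
      using perf[of U] less.prems(3) unfolding min_max_on_def U_def[symmetric] by blast
    define u where "u v = w v - of_bool (v \<in> K)" for v
    have w: "w v = u v + of_bool (v \<in> K)" for v
      using K(2) by (auto simp: u_def U_def)
    have "sum w UNIV = sum u UNIV + card K"
      by (simp add: w sum.distrib sum_of_bool_mem)
    then have le: "Suc (sum u UNIV) \<le> sum w UNIV - s" "s \<le> sum w UNIV"
      using K(3) by linarith+
    have "coverable (cliques E) (Suc (sum u UNIV)) w"
      by (rule coverable_Suc[OF coverable_singletons K(1)]) (simp_all add: w cliques_singleton)
    then show ?thesis
      using coverable_mono le cliques_empty by blast
  next
    case 2
    have "{v. a v > 0} \<subset> W" "{v. b v > 0} \<subset> W"
      using less.prems(3) 2(4) by auto
    have "i \<le> sum a UNIV \<and> coverable (cliques E) (sum a UNIV - i) a"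
      using 2(1) by (intro less.IH 2(2) \<open>{v. a v > 0} \<subset> W\<close>) auto
    moreover have "s - i \<le> sum b UNIV \<and> coverable (cliques E) (sum b UNIV - (s - i)) b"
      using 2(1) by (intro less.IH 2(3) \<open>{v. b v > 0} \<subset> W\<close>) auto
    moreover have "sum w UNIV = sum a UNIV + sum b UNIV"
      by (simp add: 2(4) sum.distrib)
    moreover have "i \<le> s" using 2(1) by auto
    ultimately show ?thesis
      using coverable_add[of "cliques E" "sum a UNIV - i" a "sum b UNIV - (s - i)" b] 2(4)
      by (auto elim!: back_subst[of "\<lambda>k. coverable (cliques E) k _"])
  qed
qed

text \<open>
  A minimal imperfect \<open>W\<close> without a clique cover of size \<open>\<alpha>\<close> would be the union of a clique and a
  stable set, but split graphs are perfect. So all \<open>U \<subseteq> W\<close> have such covers, and \<open>W\<close> is perfect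
  by duality.
\<close>

lemma min_max_of_decompose:
  assumes dec: "\<And>s w. s \<ge> 1 \<Longrightarrow> w \<in> symbolic_weights E s \<Longrightarrow> w \<in> secant_weights E s \<or>
      (\<exists>i\<in>{1..s - 1}. \<exists>a\<in>symbolic_weights E i. \<exists>b\<in>symbolic_weights E (s - i). w = (\<lambda>v. a v + b v))"
  shows "min_max_on (cliques E) (stable_sets E) W"
  using finite[of W]
proof (induction W rule: finite_psubset_induct)
  case (psubset W)
  show ?case
  proof (cases "min_max_on (stable_sets E) (cliques E) W")
    case True
    then show ?thesis
      using cross_systems.min_max_dual[OF cross_systems_complement] by blast
  next
    case False
    then obtain U a where U: "U \<subseteq> W" "\<And>S. S \<in> stable_sets E \<Longrightarrow> S \<subseteq> U \<Longrightarrow> card S \<le> a"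
        "\<not> coverable (cliques E) a (\<lambda>v. of_bool (v \<in> U))"
      unfolding min_max_on_def by blast
    define \<alpha> where "\<alpha> = Max (card ` {S \<in> stable_sets E. S \<subseteq> U})"
    have "\<alpha> \<in> card ` {S \<in> stable_sets E. S \<subseteq> U}"
      unfolding \<alpha>_def using stable_sets_empty by (intro Max_in) auto
    then obtain S0 where S0: "S0 \<in> stable_sets E" "S0 \<subseteq> U" "card S0 = \<alpha>" by auto
    have \<alpha>: "card S \<le> \<alpha>" if "S \<in> stable_sets E" "S \<subseteq> U" for S
      unfolding \<alpha>_def using that by (intro Max_ge) auto
    have "\<alpha> \<le> a" using U(2) S0 by blast
    then have not_cov: "\<not> coverable (cliques E) \<alpha> (\<lambda>v. of_bool (v \<in> U))"
      using U(3) coverable_mono cliques_empty by blast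
    define w where "w = (\<lambda>v. of_bool (v \<in> U) :: nat)"
    have not_cov_w: "\<not> coverable (cliques E) \<alpha> w"
      using not_cov by (simp add: w_def)
    have sum_w: "sum w A = card (A \<inter> U)" for A
      by (simp add: w_def sum_of_bool_mem)
    \<comment> \<open>\<open>s\<close> is the least number of vertices of \<open>U\<close> outside a
      stable set, the largest order that \<open>w\<close> can have. With this choice
      \<open>sum w UNIV - s\<close> is \<open>\<alpha>\<close>, the number of cliques that does not
      suffice.\<close>
    define s where "s = card (U - S0)"
    have s: "card U = s + \<alpha>"
      using S0(2,3) card_mono[of U S0] by (simp add: s_def card_Diff_subset)
    have "s \<noteq> 0"
      using coverable_singletons[OF cliques_singleton, of E w] not_cov_w s
      by (intro notI) (simp add: sum_w)
    then have "s \<ge> 1" by simp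
    have ws: "w \<in> symbolic_weights E s"
    proof -
      have "s \<le> card (- S \<inter> U)" if "S \<in> stable_sets E" for S
      proof -
        have "- S \<inter> U = U - S \<inter> U" by blast
        then have "card (- S \<inter> U) = card U - card (S \<inter> U)"
          by (simp add: card_Diff_subset)
        moreover have "card (S \<inter> U) \<le> \<alpha>"
          using stable_sets_subset[OF that] by (intro \<alpha>) auto
        ultimately show ?thesis using s by linarith
      qed
      then show ?thesis by (simp add: symbolic_weights_def sum_w)
    qed
    have cover: "s' \<le> sum w' UNIV \<and> coverable (cliques E) (sum w' UNIV - s') w'"
      if "s' \<ge> 1" "w' \<in> symbolic_weights E s'" "{v. w' v > 0} \<subset> W" for s' w'
      using clique_cover_of_symbolic_weight[OF dec psubset.IH that] by blast
    have w_not_cov: "\<not> coverable (cliques E) (sum w UNIV - s) w"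
      using not_cov_w s by (simp add: sum_w)
    \<comment> \<open>If \<open>U\<close> were a proper subset, \<open>cover\<close> would supply
      the \<open>\<alpha>\<close> cliques.\<close>
    have "U = W"
      using cover[OF \<open>s \<ge> 1\<close> ws] w_not_cov U(1) by (auto simp: w_def)
    have "w \<in> secant_weights E s"
    proof (rule ccontr)
      assume "w \<notin> secant_weights E s"
      then obtain i a b where i: "i \<in> {1..s - 1}" and ab: "a \<in> symbolic_weights E i"
          "b \<in> symbolic_weights E (s - i)" "w = (\<lambda>v. a v + b v)"
        using dec[OF \<open>s \<ge> 1\<close> ws] by blast
      \<comment> \<open>Factors of positive order are nonzero. As \<open>w\<close> only takes the
        values 0 and 1, their supports are disjoint, so each is a proper subset of \<open>W\<close>,
        and \<open>cover\<close> applies to both factors although not to \<open>w\<close>.\<close>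
      have ex: "\<exists>v. c v > 0" if "c \<in> symbolic_weights E j" "j \<ge> 1" for c j
      proof (rule ccontr)
        assume "\<nexists>v. c v > 0"
        then have "sum c (- {}) = 0" by simp
        then show False using that stable_sets_empty by (force simp: symbolic_weights_def)
      qed
      have w01: "a v + b v = of_bool (v \<in> U)" for v
        using ab(3) w_def by metis
      obtain va vb where v: "a va > 0" "b vb > 0" using ex ab i by fastforce
      have "a vb = 0" "b va = 0" "va \<in> U" "vb \<in> U"
        using v w01[of va] w01[of vb] by (auto split: if_splits simp: of_bool_def)
      moreover have "v \<in> U" if "a v > 0 \<or> b v > 0" for v
        using w01[of v] that by (cases "v \<in> U") auto
      ultimately have "{v. a v > 0} \<subset> W" "{v. b v > 0} \<subset> W"
        using U(1) by auto
      have "i \<le> sum a UNIV \<and> coverable (cliques E) (sum a UNIV - i) a"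
        using i by (intro cover ab(1) \<open>{v. a v > 0} \<subset> W\<close>) auto
      moreover have "s - i \<le> sum b UNIV \<and> coverable (cliques E) (sum b UNIV - (s - i)) b"
        using i by (intro cover ab(2) \<open>{v. b v > 0} \<subset> W\<close>) auto
      moreover have "sum w UNIV = sum a UNIV + sum b UNIV"
        by (simp add: ab(3) sum.distrib)
      moreover have "i \<le> s" using i by auto
      ultimately have "coverable (cliques E) (sum w UNIV - s) w"
        using coverable_add[of "cliques E" "sum a UNIV - i" a "sum b UNIV - (s - i)" b] ab(3)
        by (auto elim!: back_subst[of "\<lambda>k. coverable (cliques E) k _"])
      then show False using w_not_cov by blast
    qed
    then have not_stable_cov: "\<not> coverable (stable_sets E) s (\<lambda>v. of_bool (v \<in> W))"
      using \<open>U = W\<close> by (simp add: secant_weights_def w_def)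
    define Q where "Q = W - S0"
    have Q: "card Q = s" by (simp add: Q_def s_def \<open>U = W\<close>)
    have singles: "coverable (stable_sets E) (card A) (\<lambda>v. of_bool (v \<in> A))" for A
      using coverable_UN[of A "\<lambda>v. {v}" "stable_sets E"] stable_sets_singleton by simp
    \<comment> \<open>Two non-adjacent vertices of \<open>Q\<close> could share a colour; with
      \<open>S0\<close> as one further class, \<open>s\<close> colours would do for
      \<open>W\<close>.\<close>
    have Q_clique: "Q \<in> cliques E"
    proof (rule ccontr)
      assume "Q \<notin> cliques E"
      then obtain x y where xy: "x \<in> Q" "y \<in> Q" "x \<noteq> y" "{x, y} \<notin> E"
        by (auto simp: cliques_def clique_def)
      have "card {x, y} \<le> card Q"
        using xy by (intro card_mono) auto
      then have "s = Suc (Suc (card (Q - {x, y})))"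
        using xy Q by (simp add: card_Diff_subset)
      moreover have "coverable (stable_sets E) (Suc (card (Q - {x, y}))) (\<lambda>v. of_bool (v \<in> Q))"
        by (rule coverable_Suc[OF singles stable_sets_pair[OF xy(4)]]) auto
      then have "coverable (stable_sets E) (Suc (Suc (card (Q - {x, y})))) (\<lambda>v. of_bool (v \<in> W))"
        by (rule coverable_Suc[OF _ S0(1)]) (auto simp: Q_def)
      ultimately show False using not_stable_cov by simp
    qed
    \<comment> \<open>Otherwise every vertex of \<open>S0\<close> can join the class of a
      non-neighbour in \<open>Q\<close>, and the \<open>s\<close> vertices of \<open>Q\<close>
      account for all colours.\<close>
    have ext: "\<exists>v\<in>S0. insert v Q \<in> cliques E"
    proof (rule ccontr)
      assume neg: "\<not> ?thesis"
      have "\<exists>q\<in>Q. {v, q} \<notin> E" if "v \<in> S0" for v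
      proof (rule ccontr)
        assume "\<not> ?thesis"
        then have "insert v Q \<in> cliques E"
          using Q_clique by (auto simp: cliques_def clique_def insert_commute)
        then show False using neg that by blast
      qed
      then obtain f where f: "\<And>v. v \<in> S0 \<Longrightarrow> f v \<in> Q \<and> {v, f v} \<notin> E" by metis
      define T where "T q = insert q {v \<in> S0. f v = q}" for q
      have "T q \<in> stable_sets E" for q
      proof -
        have "\<not> e \<subseteq> T q" if e: "e \<in> E" for e
        proof
          assume eT: "e \<subseteq> T q"
          have "\<not> e \<subseteq> S0" using S0(1) e by (auto simp: stable_sets_def)
          then have "q \<in> e" using eT by (auto simp: T_def)
          obtain x y where "e = {x, y}" "x \<noteq> y"
            using edge_card[OF e] by (auto simp: card_2_iff)
          then obtain z where "e = {z, q}" "z \<noteq> q" using \<open>q \<in> e\<close> by auto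
          then show False using eT f[of z] e by (auto simp: T_def)
        qed
        then show ?thesis by (simp add: stable_sets_def)
      qed
      then have "coverable (stable_sets E) s (\<lambda>v. of_bool (v \<in> (\<Union>q\<in>Q. T q)))"
        using coverable_UN[of Q T "stable_sets E"] Q by simp
      then have "coverable (stable_sets E) s (\<lambda>v. of_bool (v \<in> W))"
        by (rule coverable_antimono) (use f in \<open>auto simp: T_def Q_def\<close>)
      then show False using not_stable_cov by blast
    qed
    \<comment> \<open>The clique \<open>insert v Q\<close> forces \<open>k\<close> to be at least
      \<open>s + 1\<close>, and the vertices of \<open>Q\<close> taken singly together with
      \<open>S0\<close> are \<open>s + 1\<close> classes. Proper subsets of \<open>W\<close> are
      left to the induction hypothesis.\<close>
    have "coverable (stable_sets E) k (\<lambda>v. of_bool (v \<in> W))"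
      if k: "\<forall>K\<in>cliques E. K \<subseteq> W \<longrightarrow> card K \<le> k" for k
    proof -
      obtain v where v: "v \<in> S0" "insert v Q \<in> cliques E" using ext by blast
      have "v \<notin> Q" "insert v Q \<subseteq> W" using v S0(2) U(1) by (auto simp: Q_def)
      then have "Suc s \<le> k" using k v(2) Q by force
      moreover have "coverable (stable_sets E) (Suc (card Q)) (\<lambda>v. of_bool (v \<in> W))"
        by (rule coverable_Suc[OF singles S0(1)]) (auto simp: Q_def)
      ultimately show ?thesis
        using Q coverable_mono stable_sets_empty by blast
    qed
    then show ?thesis
      using psubset.IH unfolding min_max_on_def by (metis psubsetI subset_refl)
  qed
qed

section \<open>Colourings as covers by stable sets\<close>

lemma coverable_iff_colouring:
  "coverable (stable_sets E) k (\<lambda>v. of_bool (v \<in> W)) \<longleftrightarrow>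
    (\<exists>c. c ` W \<subseteq> {..<k} \<and> proper_colouring W (induced_edges W E) c)"
proof
  assume "coverable (stable_sets E) k (\<lambda>v. of_bool (v \<in> W))"
  then obtain S where S: "\<And>j. j < k \<Longrightarrow> S j \<in> stable_sets E"
      "\<And>v. of_bool (v \<in> W) \<le> (\<Sum>j<k. of_bool (v \<in> S j) :: nat)"
    unfolding coverable_def by blast
  have "\<exists>j<k. v \<in> S j" if "v \<in> W" for v
  proof (rule ccontr)
    assume "\<not> ?thesis"
    then have "(\<Sum>j<k. of_bool (v \<in> S j) :: nat) = 0" by simp
    then show False using S(2)[of v] that by simp
  qed
  then obtain c where c: "\<And>v. v \<in> W \<Longrightarrow> c v < k \<and> v \<in> S (c v)" by metis
  have "c u \<noteq> c v" if "u \<in> W" "v \<in> W" "{u, v} \<in> E" for u v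
  proof
    assume "c u = c v"
    then have "{u, v} \<subseteq> S (c u)" using c[OF that(1)] c[OF that(2)] by simp
    then show False using S(1)[of "c u"] c that by (auto simp: stable_sets_def)
  qed
  then show "\<exists>c. c ` W \<subseteq> {..<k} \<and> proper_colouring W (induced_edges W E) c"
    using c by (intro exI[of _ c]) (auto simp: proper_colouring_def induced_edges_def)
next
  assume "\<exists>c. c ` W \<subseteq> {..<k} \<and> proper_colouring W (induced_edges W E) c"
  then obtain c where c: "c ` W \<subseteq> {..<k}" "proper_colouring W (induced_edges W E) c" by blast
  have "{v \<in> W. c v = j} \<in> stable_sets E" for j
  proof -
    have "\<not> e \<subseteq> {v \<in> W. c v = j}" if e: "e \<in> E" for e
    proof -
      obtain x y where "e = {x, y}"
        using edge_card[OF e] by (auto simp: card_2_iff)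
      then show ?thesis
        using c(2) e unfolding proper_colouring_def induced_edges_def by blast
    qed
    then show ?thesis by (simp add: stable_sets_def)
  qed
  then have "coverable (stable_sets E) k (\<lambda>v. of_bool (v \<in> (\<Union>j<k. {v \<in> W. c v = j})))"
    using coverable_UN[of "{..<k}" "\<lambda>j. {v \<in> W. c v = j}" "stable_sets E"] by simp
  then show "coverable (stable_sets E) k (\<lambda>v. of_bool (v \<in> W))"
    by (rule coverable_antimono) (use c(1) in auto)
qed

text \<open>Since \<open>\<omega> \<le> \<chi>\<close> always holds, equality means that
  \<open>\<omega>\<close> stable sets cover \<open>W\<close>. Ranging over all upper bounds
  \<open>k\<close> instead of the maximum gives the shape of \<open>min_max_on\<close>.\<close>

lemma clique_eq_chromatic_iff:
  "clique_number W (induced_edges W E) = chromatic_number W (induced_edges W E) \<longleftrightarrow>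
    (\<forall>k. (\<forall>K\<in>cliques E. K \<subseteq> W \<longrightarrow> card K \<le> k) \<longrightarrow>
      coverable (stable_sets E) k (\<lambda>v. of_bool (v \<in> W)))"
proof -
  define cov where "cov k \<longleftrightarrow> coverable (stable_sets E) k (\<lambda>v. of_bool (v \<in> W))" for k
  define A where "A = card ` {K \<in> cliques E. K \<subseteq> W}"
  have "{card C |C. C \<subseteq> W \<and> clique C (induced_edges W E)} = A"
  proof -
    have "clique C (induced_edges W E) \<longleftrightarrow> clique C E" if "C \<subseteq> W" for C
      using that by (auto simp: clique_def induced_edges_def)
    then show ?thesis by (auto simp: A_def cliques_def)
  qed
  then have \<omega>: "clique_number W (induced_edges W E) = Max A"
    by (simp add: clique_number_def)
  have \<chi>: "chromatic_number W (induced_edges W E) = (LEAST k. cov k)"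
    by (simp add: chromatic_number_def cov_def coverable_iff_colouring)
  have "cov (card W)"
    using coverable_UN[of W "\<lambda>v. {v}" "stable_sets E"] stable_sets_singleton by (simp add: cov_def)
  then have cov_\<chi>: "cov (LEAST k. cov k)" by (rule LeastI)
  have A: "finite A" "A \<noteq> {}" using cliques_empty by (auto simp: A_def)
  have card_le: "card K \<le> k" if "cov k" "K \<in> cliques E" "K \<subseteq> W" for k K
    by (rule card_clique_le[OF that(1)[unfolded cov_def] that(2)]) (use that(3) in auto)
  have "Max A \<le> (LEAST k. cov k)"
    using A card_le[OF cov_\<chi>] by (subst Max_le_iff) (auto simp: A_def)
  then have "Max A = (LEAST k. cov k) \<longleftrightarrow> (LEAST k. cov k) \<le> Max A" by auto
  also have "\<dots> \<longleftrightarrow> cov (Max A)"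
    using cov_\<chi> coverable_mono stable_sets_empty by (auto simp: cov_def intro: Least_le)
  also have "\<dots> \<longleftrightarrow> (\<forall>k. (\<forall>K\<in>cliques E. K \<subseteq> W \<longrightarrow> card K \<le> k) \<longrightarrow> cov k)"
  proof (intro iffI allI impI)
    fix k assume "cov (Max A)" "\<forall>K\<in>cliques E. K \<subseteq> W \<longrightarrow> card K \<le> k"
    moreover from this(2) have "Max A \<le> k" using A by (subst Max_le_iff) (auto simp: A_def)
    ultimately show "cov k"
      using coverable_mono stable_sets_empty by (auto simp: cov_def)
  next
    assume "\<forall>k. (\<forall>K\<in>cliques E. K \<subseteq> W \<longrightarrow> card K \<le> k) \<longrightarrow> cov k"
    moreover have "\<forall>K\<in>cliques E. K \<subseteq> W \<longrightarrow> card K \<le> Max A"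
      using A(1) by (auto simp: A_def intro: Max_ge)
    ultimately show "cov (Max A)" by blast
  qed
  finally show ?thesis unfolding \<omega> \<chi> unfolding cov_def .
qed

lemma perfect_graph_iff: "perfect_graph UNIV E \<longleftrightarrow> min_max_on (cliques E) (stable_sets E) UNIV"
  by (simp add: perfect_graph_def min_max_on_def clique_eq_chromatic_iff)

text \<open>The inclusion from right to left holds for every graph, so only the decomposability of
  symbolic weights carries information.\<close>

theorem perfect_graph_iff_weights:
  "perfect_graph UNIV E \<longleftrightarrow> (\<forall>s\<ge>1. symbolic_weights E s = secant_weights E s \<union>
    (\<Union>i\<in>{1..s - 1}. {\<lambda>v. a v + b v |a b. a \<in> symbolic_weights E i \<and> b \<in> symbolic_weights E (s - i)}))"
    (is "_ \<longleftrightarrow> (\<forall>s\<ge>1. _ = _ \<union> ?D s)")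
proof -
  have "?D s \<subseteq> symbolic_weights E s" for s
    using symbolic_weights_add[of _ _ _ "s - _"] by fastforce
  then have "(\<forall>s\<ge>1. symbolic_weights E s = secant_weights E s \<union> ?D s) \<longleftrightarrow>
      (\<forall>s\<ge>1. symbolic_weights E s \<subseteq> secant_weights E s \<union> ?D s)"
    using secant_weights_subset by blast
  also have "\<dots> \<longleftrightarrow> (\<forall>s\<ge>1. \<forall>w\<in>symbolic_weights E s. w \<in> secant_weights E s \<or>
      (\<exists>i\<in>{1..s - 1}. \<exists>a\<in>symbolic_weights E i. \<exists>b\<in>symbolic_weights E (s - i). w = (\<lambda>v. a v + b v)))"
    by blast
  also have "\<dots> \<longleftrightarrow> perfect_graph UNIV E"
    unfolding perfect_graph_iff
    using symbolic_weights_decompose min_max_of_decompose by blast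
  finally show ?thesis by blast
qed

end

section \<open>Monomial ideals\<close>

interpretation ideal: module "(*) :: 'a::comm_ring_1 \<Rightarrow> 'a \<Rightarrow> 'a"
  by (rule module_times)

text \<open>As a simplification rule, this reassociates products and loops with \<open>mult_ac\<close>.\<close>

declare ideal.scale_scale [simp del]

abbreviation "mexp \<equiv> Poly_Mapping.lookup"
abbreviation mon :: "('v \<Rightarrow>\<^sub>0 nat) \<Rightarrow> ('v, 'k::comm_ring_1) mpoly"
  where "mon m \<equiv> Poly_Mapping.single m 1"

lemma is_ideal_plus:
  assumes "is_ideal I" "is_ideal J"
  shows "is_ideal (I + J)"
proof (rule ideal.subspaceI)
  show "0 \<in> I + J"
    using set_plus_intro[OF ideal.subspace_0[OF assms(1)] ideal.subspace_0[OF assms(2)]] by simp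
next
  fix x y assume "x \<in> I + J" "y \<in> I + J"
  then obtain a b a' b' where "x = a + b" "y = a' + b'" "a \<in> I" "b \<in> J" "a' \<in> I" "b' \<in> J"
    by (auto elim!: set_plus_elim)
  then have "a + a' \<in> I" "b + b' \<in> J" "x + y = (a + a') + (b + b')"
    using assms by (simp_all add: ideal.subspace_add add_ac)
  then show "x + y \<in> I + J" by auto
next
  fix c x assume "x \<in> I + J"
  then obtain a b where "x = a + b" "a \<in> I" "b \<in> J"
    by (auto elim!: set_plus_elim)
  then show "c * x \<in> I + J"
    using assms by (auto simp: distrib_left intro!: set_plus_intro ideal.subspace_scale)
qed

lemma is_ideal_ideal_power: "is_ideal (ideal_power I r)"
  by (cases r) (simp_all add: ideal_prod_def)

lemma is_ideal_colon: "is_ideal J \<Longrightarrow> is_ideal {f. g * f \<in> J}"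
  unfolding ideal.subspace_def by (auto simp: distrib_left mult.left_commute[of g])

text \<open>Prescribing the allowed exponents, rather than generators, turns inclusions, sums and
  products into statements about exponent sets. The result is an ideal as soon as \<open>M\<close>
  is \<open>up_closed\<close>.\<close>

definition mono_ideal :: "('v \<Rightarrow>\<^sub>0 nat) set \<Rightarrow> ('v, 'k::comm_ring_1) mpoly set"
  where "mono_ideal M = {f. Poly_Mapping.keys f \<subseteq> M}"

definition up_closed :: "'a::monoid_add set \<Rightarrow> bool"
  where "up_closed M \<longleftrightarrow> (\<forall>a\<in>M. \<forall>b. b + a \<in> M)"

lemma mono_in_mono_ideal [simp]: "mon m \<in> mono_ideal M \<longleftrightarrow> m \<in> M"
  by (simp add: mono_ideal_def)

lemma is_ideal_mono_ideal:
  assumes "up_closed M"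
  shows "is_ideal (mono_ideal M :: ('v, 'k::comm_ring_1) mpoly set)"
proof (rule ideal.subspaceI)
  show "0 \<in> (mono_ideal M :: ('v, 'k) mpoly set)" by (simp add: mono_ideal_def)
next
  fix f g :: "('v, 'k) mpoly"
  assume "f \<in> mono_ideal M" "g \<in> mono_ideal M"
  then show "f + g \<in> mono_ideal M" using keys_add[of f g] by (auto simp: mono_ideal_def)
next
  fix f g :: "('v, 'k) mpoly"
  assume "g \<in> mono_ideal M"
  then show "f * g \<in> mono_ideal M"
    using keys_mult[of f g] assms by (fastforce simp: mono_ideal_def up_closed_def)
qed

lemma sum_single_keys: "(\<Sum>m\<in>Poly_Mapping.keys f. Poly_Mapping.single m (mexp f m)) = f"
proof (rule poly_mapping_eqI)
  fix k
  have "mexp (\<Sum>m\<in>Poly_Mapping.keys f. Poly_Mapping.single m (mexp f m)) k =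
      (\<Sum>m\<in>Poly_Mapping.keys f. if m = k then mexp f m else 0)"
    by (simp add: lookup_sum lookup_single when_def)
  also have "\<dots> = mexp f k" by (simp add: sum.delta in_keys_iff)
  finally show "mexp (\<Sum>m\<in>Poly_Mapping.keys f. Poly_Mapping.single m (mexp f m)) k = mexp f k" .
qed

lemma mono_mult: "mon a * mon b = mon (a + b)"
  by (simp add: mult_single)

lemma mono_ideal_subset:
  fixes J :: "('v, 'k::comm_ring_1) mpoly set"
  assumes "is_ideal J" "\<And>m. m \<in> M \<Longrightarrow> mon m \<in> J"
  shows "mono_ideal M \<subseteq> J"
proof
  fix f :: "('v, 'k) mpoly"
  assume f: "f \<in> mono_ideal M"
  have "Poly_Mapping.single m c \<in> J" if "m \<in> M" for m c
    using ideal.subspace_scale[OF assms(1) assms(2)[OF that], of "Poly_Mapping.single 0 c"]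
    by (simp add: mult_single)
  then have "(\<Sum>m\<in>Poly_Mapping.keys f. Poly_Mapping.single m (mexp f m)) \<in> J"
    using f by (intro ideal.subspace_sum assms(1)) (auto simp: mono_ideal_def)
  then show "f \<in> J" by (simp add: sum_single_keys)
qed

lemma mono_ideal_subset_iff:
  "(mono_ideal A :: ('v, 'k::comm_ring_1) mpoly set) \<subseteq> mono_ideal B \<longleftrightarrow> A \<subseteq> B"
proof
  assume sub: "(mono_ideal A :: ('v, 'k) mpoly set) \<subseteq> mono_ideal B"
  show "A \<subseteq> B"
  proof
    fix m assume "m \<in> A"
    then have "(mon m :: ('v, 'k) mpoly) \<in> mono_ideal A" by simp
    then show "m \<in> B" using sub mono_in_mono_ideal by blast
  qed
qed (auto simp: mono_ideal_def)

lemma mono_ideal_eq_iff: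
  "(mono_ideal A :: ('v, 'k::comm_ring_1) mpoly set) = mono_ideal B \<longleftrightarrow> A = B"
  by (simp only: set_eq_subset mono_ideal_subset_iff)

lemma mono_ideal_plus:
  fixes A B :: "('v \<Rightarrow>\<^sub>0 nat) set"
  assumes "up_closed A" "up_closed B"
  shows "mono_ideal A + mono_ideal B = (mono_ideal (A \<union> B) :: ('v, 'k::comm_ring_1) mpoly set)"
proof
  show "mono_ideal A + mono_ideal B \<subseteq> (mono_ideal (A \<union> B) :: ('v, 'k) mpoly set)"
    using keys_add by (fastforce simp: mono_ideal_def set_plus_def)
  have "0 \<in> (mono_ideal A :: ('v, 'k) mpoly set)" "0 \<in> (mono_ideal B :: ('v, 'k) mpoly set)"
    by (simp_all add: mono_ideal_def)
  then have "mon m \<in> (mono_ideal A + mono_ideal B :: ('v, 'k) mpoly set)" if "m \<in> A \<union> B" for m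
    using that by (metis Un_iff mono_in_mono_ideal add_0 add_0_right set_plus_intro)
  then show "mono_ideal (A \<union> B) \<subseteq> (mono_ideal A + mono_ideal B :: ('v, 'k) mpoly set)"
    by (intro mono_ideal_subset is_ideal_plus is_ideal_mono_ideal assms)
qed

lemma up_closed_UN: "(\<And>i. i \<in> N \<Longrightarrow> up_closed (A i)) \<Longrightarrow> up_closed (\<Union>i\<in>N. A i)"
  unfolding up_closed_def by blast

lemma mono_ideal_sum:
  fixes A :: "'i \<Rightarrow> ('v \<Rightarrow>\<^sub>0 nat) set"
  assumes "finite N" "\<And>i. i \<in> N \<Longrightarrow> up_closed (A i)"
  shows "(\<Sum>i\<in>N. mono_ideal (A i)) = (mono_ideal (\<Union>i\<in>N. A i) :: ('v, 'k::comm_ring_1) mpoly set)"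
  using assms
proof (induction N rule: finite_induct)
  case empty
  then show ?case by (auto simp: mono_ideal_def set_zero)
next
  case (insert i N)
  then show ?case by (simp add: mono_ideal_plus up_closed_UN)
qed

lemma mono_ideal_prod:
  fixes A B :: "('v \<Rightarrow>\<^sub>0 nat) set"
  assumes "up_closed A"
  shows "ideal_prod (mono_ideal A) (mono_ideal B) =
    (mono_ideal {a + b |a b. a \<in> A \<and> b \<in> B} :: ('v, 'k::comm_ring_1) mpoly set)"
proof
  have up: "up_closed {a + b |a b. a \<in> A \<and> b \<in> B}"
    using assms by (fastforce simp: up_closed_def add.assoc[symmetric])
  show "ideal_prod (mono_ideal A) (mono_ideal B) \<subseteq>
      (mono_ideal {a + b |a b. a \<in> A \<and> b \<in> B} :: ('v, 'k) mpoly set)"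
    unfolding ideal_prod_def
  proof (rule ideal.span_minimal[OF _ is_ideal_mono_ideal[OF up]], safe)
    fix f g :: "('v, 'k) mpoly"
    assume "f \<in> mono_ideal A" "g \<in> mono_ideal B"
    then show "f * g \<in> mono_ideal {a + b |a b. a \<in> A \<and> b \<in> B}"
      using keys_mult[of f g] unfolding mono_ideal_def by blast
  qed
  have "mon (a + b) \<in> (ideal_prod (mono_ideal A) (mono_ideal B) :: ('v, 'k) mpoly set)"
    if "a \<in> A" "b \<in> B" for a b
    unfolding ideal_prod_def using that
    by (intro ideal.span_base CollectI exI[of _ "mon a"] exI[of _ "mon b"]) (simp add: mono_mult)
  then show "mono_ideal {a + b |a b. a \<in> A \<and> b \<in> B} \<subseteq>
      (ideal_prod (mono_ideal A) (mono_ideal B) :: ('v, 'k) mpoly set)"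
    by (intro mono_ideal_subset) (auto simp: ideal_prod_def)
qed

section \<open>Lowest terms of products\<close>

text \<open>The exponents of one variable after another are minimised, a lexicographic minimum that
  needs no order on the variables. Minimal exponents add up to the minimum of all sums, so a pair
  with the same sum is minimal in both entries.\<close>

lemma ex_unique_sum:
  fixes A B :: "('v \<Rightarrow>\<^sub>0 nat) set"
  assumes "finite U" "finite A" "A \<noteq> {}" "finite B" "B \<noteq> {}"
  shows "\<exists>a\<in>A. \<exists>b\<in>B. \<forall>a'\<in>A. \<forall>b'\<in>B. a' + b' = a + b \<longrightarrow>
    (\<forall>i\<in>U. mexp a' i = mexp a i \<and> mexp b' i = mexp b i)"
  using assms
proof (induction U arbitrary: A B rule: finite_induct)
  case empty
  then show ?case by auto
next
  case (insert u U)
  define \<alpha> where "\<alpha> = Min ((\<lambda>a. mexp a u) ` A)"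
  define \<beta> where "\<beta> = Min ((\<lambda>b. mexp b u) ` B)"
  have \<alpha>: "\<alpha> \<le> mexp a u" if "a \<in> A" for a
    unfolding \<alpha>_def using that insert.prems by auto
  have \<beta>: "\<beta> \<le> mexp b u" if "b \<in> B" for b
    unfolding \<beta>_def using that insert.prems by auto
  define A' where "A' = {a \<in> A. mexp a u = \<alpha>}"
  define B' where "B' = {b \<in> B. mexp b u = \<beta>}"
  have "\<alpha> \<in> (\<lambda>a. mexp a u) ` A" "\<beta> \<in> (\<lambda>b. mexp b u) ` B"
    unfolding \<alpha>_def \<beta>_def using insert.prems by (auto intro!: Min_in simp del: image_iff)
  then have "A' \<noteq> {}" "B' \<noteq> {}" by (auto simp: A'_def B'_def)
  moreover have "finite A'" "finite B'" using insert.prems by (auto simp: A'_def B'_def)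
  ultimately obtain a b where ab: "a \<in> A'" "b \<in> B'"
    "\<And>a' b'. a' \<in> A' \<Longrightarrow> b' \<in> B' \<Longrightarrow> a' + b' = a + b \<Longrightarrow>
      (\<forall>i\<in>U. mexp a' i = mexp a i \<and> mexp b' i = mexp b i)"
    using insert.IH[of A' B'] by metis
  have "\<forall>i\<in>insert u U. mexp a' i = mexp a i \<and> mexp b' i = mexp b i"
    if that': "a' \<in> A" "b' \<in> B" "a' + b' = a + b" for a' b'
  proof -
    have "mexp a' u + mexp b' u = \<alpha> + \<beta>"
      using arg_cong[OF that'(3), of "\<lambda>m. mexp m u"] ab(1,2) by (simp add: lookup_add A'_def B'_def)
    then have "mexp a' u = \<alpha>" "mexp b' u = \<beta>"
      using \<alpha>[OF that'(1)] \<beta>[OF that'(2)] by linarith+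
    moreover from this have "a' \<in> A'" "b' \<in> B'" using that' by (simp_all add: A'_def B'_def)
    moreover have "mexp a u = \<alpha>" "mexp b u = \<beta>" using ab(1,2) by (simp_all add: A'_def B'_def)
    ultimately show ?thesis using ab(3) that'(3) by simp
  qed
  moreover have "a \<in> A" "b \<in> B" using ab(1,2) by (simp_all add: A'_def B'_def)
  ultimately show ?case by blast
qed

lemma lookup_mult_unique:
  fixes f g :: "('v, 'k::comm_ring_1) mpoly"
  assumes "a \<in> Poly_Mapping.keys f" "b \<in> Poly_Mapping.keys g"
    and uniq: "\<And>a' b'. a' \<in> Poly_Mapping.keys f \<Longrightarrow> b' \<in> Poly_Mapping.keys g \<Longrightarrow>
      a' + b' = a + b \<Longrightarrow> a' = a \<and> b' = b"
  shows "mexp (f * g) (a + b) = mexp f a * mexp g b"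
proof -
  let ?F = "Poly_Mapping.keys f" and ?G = "Poly_Mapping.keys g"
  have "f * g = (\<Sum>a'\<in>?F. Poly_Mapping.single a' (mexp f a')) * (\<Sum>b'\<in>?G. Poly_Mapping.single b' (mexp g b'))"
    by (simp add: sum_single_keys)
  also have "\<dots> = (\<Sum>(a', b')\<in>?F \<times> ?G. Poly_Mapping.single (a' + b') (mexp f a' * mexp g b'))"
    by (simp add: sum_product sum.cartesian_product mult_single)
  finally have "mexp (f * g) (a + b) =
      (\<Sum>(a', b')\<in>?F \<times> ?G. mexp f a' * mexp g b' when a' + b' = a + b)"
    by (simp add: lookup_sum lookup_single case_prod_unfold)
  also have "\<dots> = (\<Sum>(a', b')\<in>{(a, b)}. mexp f a' * mexp g b' when a' + b' = a + b)"
    using assms(1,2) by (intro sum.mono_neutral_right) (auto simp: when_def split: if_splits dest: uniq)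
  finally show ?thesis by simp
qed

text \<open>Only pairs of lowest terms reach the lowest value of \<open>l\<close> in the product.
  Among them \<open>ex_unique_sum\<close> picks a sum that arises only once, and in a domain its
  coefficient does not vanish.\<close>

lemma ex_lowest_term_mult:
  fixes f g :: "('v, 'k::idom) mpoly" and l :: "('v \<Rightarrow>\<^sub>0 nat) \<Rightarrow> nat"
  assumes l: "\<And>a b. l (a + b) = l a + l b" and "f \<noteq> 0" "g \<noteq> 0"
  obtains a b where "a \<in> Poly_Mapping.keys f" "b \<in> Poly_Mapping.keys g"
    "a + b \<in> Poly_Mapping.keys (f * g)"
    "\<And>a'. a' \<in> Poly_Mapping.keys f \<Longrightarrow> l a \<le> l a'" "\<And>b'. b' \<in> Poly_Mapping.keys g \<Longrightarrow> l b \<le> l b'"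
proof -
  let ?F = "Poly_Mapping.keys f" and ?G = "Poly_Mapping.keys g"
  define \<alpha> where "\<alpha> = Min (l ` ?F)"
  define \<beta> where "\<beta> = Min (l ` ?G)"
  have \<alpha>: "\<alpha> \<le> l a" if "a \<in> ?F" for a
    unfolding \<alpha>_def using that by auto
  have \<beta>: "\<beta> \<le> l b" if "b \<in> ?G" for b
    unfolding \<beta>_def using that by auto
  have "?F \<noteq> {}" "?G \<noteq> {}"
    using assms(2,3) sum_single_keys by (metis sum.empty)+
  then have "\<alpha> \<in> l ` ?F" "\<beta> \<in> l ` ?G"
    unfolding \<alpha>_def \<beta>_def by (intro Min_in; simp)+
  define A where "A = {a \<in> ?F. l a = \<alpha>}"
  define B where "B = {b \<in> ?G. l b = \<beta>}"
  have fin: "finite A" "finite B" by (simp_all add: A_def B_def)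
  have ne: "A \<noteq> {}" "B \<noteq> {}"
    using \<open>\<alpha> \<in> l ` ?F\<close> \<open>\<beta> \<in> l ` ?G\<close> by (auto simp: A_def B_def)
  define U where "U = (\<Union>m\<in>A \<union> B. Poly_Mapping.keys m)"
  have "finite U" using fin by (simp add: U_def)
  then obtain a b where ab: "a \<in> A" "b \<in> B"
    "\<And>a' b'. a' \<in> A \<Longrightarrow> b' \<in> B \<Longrightarrow> a' + b' = a + b \<Longrightarrow>
      (\<forall>i\<in>U. mexp a' i = mexp a i \<and> mexp b' i = mexp b i)"
    using ex_unique_sum[OF _ fin(1) ne(1) fin(2) ne(2)] by metis
  have eqI: "m = m'" if "m \<in> A \<union> B" "m' \<in> A \<union> B" "\<forall>i\<in>U. mexp m i = mexp m' i" for m m'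
  proof (rule poly_mapping_eqI)
    fix i
    show "mexp m i = mexp m' i"
    proof (cases "i \<in> U")
      case False
      then have "i \<notin> Poly_Mapping.keys m" "i \<notin> Poly_Mapping.keys m'" using that by (auto simp: U_def)
      then show ?thesis by (simp add: in_keys_iff)
    qed (use that in blast)
  qed
  have "a' = a \<and> b' = b" if "a' \<in> ?F" "b' \<in> ?G" "a' + b' = a + b" for a' b'
  proof -
    have "l a' + l b' = \<alpha> + \<beta>"
      using arg_cong[OF that(3), of l] ab by (simp add: l A_def B_def)
    then have "l a' = \<alpha>" "l b' = \<beta>" using \<alpha>[OF that(1)] \<beta>[OF that(2)] by linarith+
    then have "a' \<in> A" "b' \<in> B" using that by (auto simp: A_def B_def)
    then show ?thesis using ab(3)[OF _ _ that(3)] ab(1,2) eqI[of a' a] eqI[of b' b] by blast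
  qed
  then have "mexp (f * g) (a + b) = mexp f a * mexp g b"
    using ab by (intro lookup_mult_unique) (auto simp: A_def B_def)
  moreover have "mexp f a \<noteq> 0" "mexp g b \<noteq> 0"
    using ab by (auto simp: A_def B_def in_keys_iff)
  ultimately have "a + b \<in> Poly_Mapping.keys (f * g)" by (simp add: in_keys_iff)
  then show ?thesis
    using ab \<alpha> \<beta> by (intro that[of a b]) (auto simp: A_def B_def)
qed

section \<open>Substitution\<close>

definition mono_subst :: "('v \<Rightarrow> 'a::comm_ring_1) \<Rightarrow> ('v \<Rightarrow>\<^sub>0 nat) \<Rightarrow> 'a"
  where "mono_subst h m = (\<Prod>i\<in>Poly_Mapping.keys m. h i ^ mexp m i)"

text \<open>Generalises \<open>rename\<close> to images that need not be variables, so that setting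
  variables to 0 is a substitution too.\<close>

definition subst :: "('v \<Rightarrow> ('w, 'k) mpoly) \<Rightarrow> ('v, 'k::comm_ring_1) mpoly \<Rightarrow> ('w, 'k) mpoly"
  where "subst h p = (\<Sum>m\<in>Poly_Mapping.keys p. Const (mexp p m) * mono_subst h m)"

lemma rename_eq_subst: "rename f = subst (\<lambda>i. Var (f i))"
  by (simp add: rename_def subst_def mono_subst_def fun_eq_iff)

lemma mono_subst_0 [simp]: "mono_subst h 0 = 1"
  by (simp add: mono_subst_def)

lemma mono_subst_add: "mono_subst h (a + b) = mono_subst h a * mono_subst h b"
proof -
  let ?U = "Poly_Mapping.keys a \<union> Poly_Mapping.keys b"
  have ext: "mono_subst h m = (\<Prod>i\<in>?U. h i ^ mexp m i)" if "Poly_Mapping.keys m \<subseteq> ?U" for m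
    unfolding mono_subst_def using that by (intro prod.mono_neutral_left) (auto simp: in_keys_iff)
  show ?thesis
    using keys_add[of a b] by (simp add: ext lookup_add power_add prod.distrib)
qed

lemma mono_subst_single: "mono_subst h (Poly_Mapping.single i n) = h i ^ n"
  by (simp add: mono_subst_def)

lemma Const_0 [simp]: "Const 0 = 0"
  and Const_1 [simp]: "Const 1 = 1"
  and Const_add: "Const (a + b) = Const a + Const b"
  and Const_mult: "Const (a * b) = Const a * Const b"
  by (simp_all add: Const_def single_add mult_single)

lemma subst_0 [simp]: "subst h 0 = 0"
  by (simp add: subst_def)

lemma subst_add: "subst h (p + q) = subst h p + subst h q"
  unfolding subst_def
  by (rule setsum_keys_plus_distrib[where f = "\<lambda>m c. Const c * mono_subst h m"])
    (simp_all add: Const_add distrib_right)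

lemma subst_sum: "subst h (sum f A) = (\<Sum>a\<in>A. subst h (f a))"
  by (induction A rule: infinite_finite_induct) (simp_all add: subst_add)

lemma subst_single: "subst h (Poly_Mapping.single m c) = Const c * mono_subst h m"
  by (simp add: subst_def)

lemma subst_mult: "subst h (p * q) = subst h p * subst h q"
proof -
  let ?S = "\<lambda>p m. Poly_Mapping.single m (mexp p m)"
  have "subst h (p * q) = subst h ((\<Sum>a\<in>Poly_Mapping.keys p. ?S p a) * (\<Sum>b\<in>Poly_Mapping.keys q. ?S q b))"
    by (simp add: sum_single_keys)
  also have "\<dots> = (\<Sum>a\<in>Poly_Mapping.keys p. \<Sum>b\<in>Poly_Mapping.keys q. subst h (?S p a * ?S q b))"
    by (simp add: sum_product subst_sum)
  also have "\<dots> = (\<Sum>a\<in>Poly_Mapping.keys p. \<Sum>b\<in>Poly_Mapping.keys q. subst h (?S p a) * subst h (?S q b))"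
    by (simp add: mult_single subst_single Const_mult mono_subst_add mult_ac)
  also have "\<dots> = subst h (\<Sum>a\<in>Poly_Mapping.keys p. ?S p a) * subst h (\<Sum>b\<in>Poly_Mapping.keys q. ?S q b)"
    by (simp add: sum_product subst_sum)
  finally show ?thesis by (simp add: sum_single_keys)
qed

lemma subst_1 [simp]: "subst h 1 = 1"
  using subst_single[of h 0 1] by simp

lemma subst_Var: "subst h (Var i) = h i"
  by (simp add: Var_def subst_single mono_subst_single)

lemma subst_Const: "subst h (Const c) = Const c"
  by (simp add: Const_def[of c] subst_single)

lemma subst_diff: "subst h (p - q) = subst h p - subst h q"
  using subst_add[of h "p - q" q] by simp

lemma subst_power: "subst h (p ^ n) = subst h p ^ n"
  by (induction n) (simp_all add: subst_mult)

lemma subst_prod: "subst h (prod f A) = (\<Prod>a\<in>A. subst h (f a))"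
  by (induction A rule: infinite_finite_induct) (simp_all add: subst_mult)

lemma subst_rename: "subst h (rename f p) = subst (\<lambda>i. h (f i)) p"
  unfolding rename_def subst_sum subst_mult subst_prod subst_power subst_Var subst_Const
  by (simp add: subst_def mono_subst_def)

lemma mono_subst_Var: "mono_subst Var m = (mon m :: ('v, 'k::comm_ring_1) mpoly)"
proof -
  have pow: "Var i ^ n = (mon (Poly_Mapping.single i n) :: ('v, 'k) mpoly)" for i n
    by (induction n) (simp_all add: Var_def mono_mult single_add[symmetric])
  have "(\<Prod>i\<in>A. mon (Poly_Mapping.single i (mexp m i))) =
      (mon (\<Sum>i\<in>A. Poly_Mapping.single i (mexp m i)) :: ('v, 'k) mpoly)" for A
    by (induction A rule: infinite_finite_induct) (simp_all add: mono_mult)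
  then show ?thesis by (simp only: mono_subst_def pow sum_single_keys)
qed

lemma is_ideal_subst_vimage: "is_ideal J \<Longrightarrow> is_ideal {p. subst h p \<in> J}"
  unfolding ideal.subspace_def by (auto simp: subst_add subst_mult)

section \<open>Symbolic powers of edge ideals\<close>

abbreviation cdeg :: "'v set \<Rightarrow> ('v \<Rightarrow>\<^sub>0 nat) \<Rightarrow> nat"
  where "cdeg C m \<equiv> sum (mexp m) C"

lemma cdeg_add: "cdeg C (a + b) = cdeg C a + cdeg C b"
  by (simp add: lookup_add sum.distrib)

text \<open>The \<open>s\<close>-th power of the prime ideal \<open>\<langle>x\<^sub>i | i \<in> C\<rangle>\<close>.\<close>

definition order_ideal :: "'v set \<Rightarrow> nat \<Rightarrow> ('v, 'k::comm_ring_1) mpoly set"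
  where "order_ideal C s = mono_ideal {m. s \<le> cdeg C m}"

lemma is_ideal_order_ideal: "is_ideal (order_ideal C s)"
  unfolding order_ideal_def
  by (rule is_ideal_mono_ideal) (auto simp: up_closed_def cdeg_add)

lemma order_ideal_mult:
  assumes "f \<in> order_ideal C r" "g \<in> order_ideal C s"
  shows "f * g \<in> order_ideal C (r + s)"
proof -
  have "r + s \<le> cdeg C m" if "m \<in> Poly_Mapping.keys (f * g)" for m
  proof -
    obtain a b where "m = a + b" "a \<in> Poly_Mapping.keys f" "b \<in> Poly_Mapping.keys g"
      using \<open>m \<in> Poly_Mapping.keys (f * g)\<close> keys_mult[of f g] by blast
    moreover from this have "r \<le> cdeg C a" "s \<le> cdeg C b"
      using assms unfolding order_ideal_def mono_ideal_def by blast+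
    ultimately show ?thesis by (simp only: cdeg_add add_mono)
  qed
  then show ?thesis by (auto simp: order_ideal_def mono_ideal_def)
qed

text \<open>Lowest degrees in the variables of \<open>C\<close> add up, and \<open>g\<close> has a
  term free of these variables, so a nonzero \<open>f\<close> has the same lowest degree as
  \<open>g * f\<close>. For \<open>s = 1\<close> this yields primality; for larger \<open>s\<close>
  it says that the powers of the prime are primary.\<close>

lemma order_ideal_cancel:
  fixes f g :: "('v, 'k::idom) mpoly"
  assumes "g * f \<in> order_ideal C s" "g \<notin> order_ideal C 1"
  shows "f \<in> order_ideal C s"
proof (cases "f = 0")
  case True
  then show ?thesis using ideal.subspace_0[OF is_ideal_order_ideal] by simp
next
  case False
  have "g \<noteq> 0" using assms(2) ideal.subspace_0[OF is_ideal_order_ideal] by blast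
  then obtain a b where ab: "a \<in> Poly_Mapping.keys g" "a + b \<in> Poly_Mapping.keys (g * f)"
      "\<And>a'. a' \<in> Poly_Mapping.keys g \<Longrightarrow> cdeg C a \<le> cdeg C a'"
      "\<And>b'. b' \<in> Poly_Mapping.keys f \<Longrightarrow> cdeg C b \<le> cdeg C b'"
    using ex_lowest_term_mult[of "cdeg C" g f] cdeg_add False by metis
  obtain a' where "a' \<in> Poly_Mapping.keys g" "\<not> 1 \<le> cdeg C a'"
    using assms(2) unfolding order_ideal_def mono_ideal_def by blast
  then have "cdeg C a = 0" using ab(3)[of a'] by linarith
  moreover have "s \<le> cdeg C (a + b)"
    using assms(1) ab(2) unfolding order_ideal_def mono_ideal_def by blast
  ultimately have "s \<le> cdeg C b" by (simp add: cdeg_add)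
  then show ?thesis
    using ab(4) unfolding order_ideal_def mono_ideal_def by (auto intro: le_trans)
qed

lemma prime_ideal_order_ideal: "prime_ideal (order_ideal C 1 :: ('v, 'k::idom) mpoly set)"
proof -
  have "(1 :: ('v, 'k) mpoly) \<notin> order_ideal C 1"
    by (simp add: order_ideal_def mono_ideal_def)
  then show ?thesis
    unfolding prime_ideal_def using order_ideal_cancel is_ideal_order_ideal by blast
qed

lemma order_ideal_1_subset_iff:
  fixes C D :: "'v::finite set"
  shows "(order_ideal C 1 :: ('v, 'k::comm_ring_1) mpoly set) \<subseteq> order_ideal D 1 \<longleftrightarrow> C \<subseteq> D"
proof
  assume sub: "(order_ideal C 1 :: ('v, 'k) mpoly set) \<subseteq> order_ideal D 1"
  show "C \<subseteq> D"
  proof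
    fix i assume "i \<in> C"
    have deg: "cdeg A (Poly_Mapping.single i 1) = of_bool (i \<in> A)" for A
      by (simp add: lookup_single when_def)
    from sub have "1 \<le> cdeg C m \<Longrightarrow> 1 \<le> cdeg D m" for m
      unfolding order_ideal_def mono_ideal_subset_iff by blast
    from this[of "Poly_Mapping.single i 1"] show "i \<in> D"
      using \<open>i \<in> C\<close> unfolding deg by (cases "i \<in> D") simp_all
  qed
next
  assume "C \<subseteq> D"
  then have "cdeg C m \<le> cdeg D m" for m by (intro sum_mono2) auto
  then show "(order_ideal C 1 :: ('v, 'k) mpoly set) \<subseteq> order_ideal D 1"
    unfolding order_ideal_def mono_ideal_subset_iff by (meson Collect_mono le_trans)
qed

lemma keys_indicator: "finite S \<Longrightarrow> mexp (\<Sum>i\<in>S. Poly_Mapping.single i r) v = (if v \<in> S then r else 0)"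
  by (simp add: lookup_sum lookup_single when_def)

lemma mono_eq_Var_mult:
  fixes m :: "'v \<Rightarrow>\<^sub>0 nat"
  assumes "mexp m i \<ge> 1"
  shows "mon m = (mon (m - Poly_Mapping.single i 1) * Var i :: ('v, 'k::comm_ring_1) mpoly)"
proof -
  have "m = (m - Poly_Mapping.single i 1) + Poly_Mapping.single i 1"
    using assms by (intro poly_mapping_eqI) (auto simp: lookup_add lookup_minus lookup_single when_def)
  then show ?thesis unfolding Var_def mono_mult by (rule arg_cong)
qed

lemma order_ideal_1_subset:
  fixes C :: "'v::finite set" and J :: "('v, 'k::comm_ring_1) mpoly set"
  assumes "is_ideal J" "\<And>i. i \<in> C \<Longrightarrow> Var i \<in> J"
  shows "order_ideal C 1 \<subseteq> J"
  unfolding order_ideal_def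
proof (rule mono_ideal_subset[OF assms(1)], safe)
  fix m :: "'v \<Rightarrow>\<^sub>0 nat" assume "1 \<le> cdeg C m"
  then have "cdeg C m \<noteq> 0" by linarith
  then obtain i where "i \<in> C" "mexp m i \<noteq> 0" by (metis sum.neutral)
  then have "mon m = (mon (m - Poly_Mapping.single i 1) * Var i :: ('v, 'k) mpoly)" "Var i \<in> J"
    using assms(2) mono_eq_Var_mult[of m i] by simp_all
  then show "mon m \<in> J" using ideal.subspace_scale[OF assms(1)] by metis
qed

section \<open>Minimal primes of the edge ideal\<close>

text \<open>The complements are the minimal vertex covers, which index the minimal primes.\<close>

definition max_stable_sets :: "'v set set \<Rightarrow> 'v set set"
  where "max_stable_sets E = {S \<in> stable_sets E. \<forall>S'\<in>stable_sets E. S \<subseteq> S' \<longrightarrow> S' = S}"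

lemma ex_max_stable_set:
  fixes E :: "'v::finite set set"
  assumes "S \<in> stable_sets E"
  shows "\<exists>S'\<in>max_stable_sets E. S \<subseteq> S'"
  using finite_has_maximal2[of "stable_sets E" S] assms unfolding max_stable_sets_def by auto

context
  fixes E :: "'v::finite set set"
  assumes E: "E \<subseteq> [UNIV]\<^bsup>2\<^esup>"
begin

lemma edge_obtain:
  assumes "e \<in> E"
  obtains i j where "e = {i, j}" "i \<noteq> j"
  using edge_card[OF E assms] by (auto simp: card_2_iff)

lemma edge_ideal_eq:
  "(edge_ideal E :: ('v, 'k::comm_ring_1) mpoly set) = mono_ideal {m. Poly_Mapping.keys m \<notin> stable_sets E}"
    (is "_ = mono_ideal ?M")
proof
  have up: "up_closed ?M"
  proof -
    have "Poly_Mapping.keys a \<subseteq> Poly_Mapping.keys (b + a)" for a b :: "'v \<Rightarrow>\<^sub>0 nat"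
      by (auto simp: in_keys_iff lookup_add)
    then show ?thesis using stable_sets_subset unfolding up_closed_def by blast
  qed
  show "edge_ideal E \<subseteq> (mono_ideal ?M :: ('v, 'k) mpoly set)"
    unfolding edge_ideal_def
  proof (rule ideal.span_minimal[OF _ is_ideal_mono_ideal[OF up]], safe)
    fix i j assume "{i, j} \<in> E"
    moreover have "{i, j} \<subseteq> Poly_Mapping.keys (Poly_Mapping.single i 1 + Poly_Mapping.single j (1 :: nat))"
      by (auto simp: in_keys_iff lookup_add)
    ultimately have "Poly_Mapping.single i 1 + Poly_Mapping.single j 1 \<in> ?M"
      unfolding stable_sets_def by blast
    then show "Var i * Var j \<in> (mono_ideal ?M :: ('v, 'k) mpoly set)"
      unfolding Var_def mono_mult by simp
  qed
  show "mono_ideal ?M \<subseteq> (edge_ideal E :: ('v, 'k) mpoly set)"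
  proof (rule mono_ideal_subset)
    show idl: "is_ideal (edge_ideal E :: ('v, 'k) mpoly set)"
      by (simp add: edge_ideal_def)
    fix m :: "'v \<Rightarrow>\<^sub>0 nat" assume "m \<in> ?M"
    then obtain e where e: "e \<in> E" "e \<subseteq> Poly_Mapping.keys m" by (auto simp: stable_sets_def)
    then obtain i j where ij: "e = {i, j}" "i \<noteq> j" using edge_obtain by blast
    let ?m1 = "m - Poly_Mapping.single i 1"
    have "mexp m i \<ge> 1" "mexp ?m1 j \<ge> 1"
      using e(2) ij by (auto simp: in_keys_iff lookup_minus lookup_single when_def)
    then have "(mon m :: ('v, 'k) mpoly) = mon (?m1 - Poly_Mapping.single j 1) * (Var i * Var j)"
      by (simp only: mono_eq_Var_mult[of m i] mono_eq_Var_mult[of ?m1 j] mult_ac)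
    moreover have "Var i * Var j \<in> (edge_ideal E :: ('v, 'k) mpoly set)"
      unfolding edge_ideal_def using e(1) ij(1) by (intro ideal.span_base) blast
    ultimately show "(mon m :: ('v, 'k) mpoly) \<in> edge_ideal E"
      using ideal.subspace_scale[OF idl] by simp
  qed
qed

lemma edge_ideal_subset_order_ideal_iff:
  "(edge_ideal E :: ('v, 'k::comm_ring_1) mpoly set) \<subseteq> order_ideal C 1 \<longleftrightarrow> - C \<in> stable_sets E"
proof
  assume sub: "(edge_ideal E :: ('v, 'k) mpoly set) \<subseteq> order_ideal C 1"
  \<comment> \<open>The product of all variables outside \<open>C\<close> has the largest support
    among the monomials of \<open>C\<close>-degree 0, so it is the one to test.\<close>
  let ?m = "\<Sum>i\<in>- C. Poly_Mapping.single i (1 :: nat)"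
  have "cdeg C ?m = 0" by (simp add: keys_indicator)
  then have "Poly_Mapping.keys ?m \<in> stable_sets E"
    using sub unfolding edge_ideal_eq order_ideal_def mono_ideal_subset_iff by fastforce
  moreover have "Poly_Mapping.keys ?m = - C"
    by (auto simp: in_keys_iff keys_indicator)
  ultimately show "- C \<in> stable_sets E" by simp
next
  assume C: "- C \<in> stable_sets E"
  have "1 \<le> cdeg C m" if "Poly_Mapping.keys m \<notin> stable_sets E" for m
  proof (rule ccontr)
    assume "\<not> 1 \<le> cdeg C m"
    then have "cdeg C m = 0" by linarith
    then have "Poly_Mapping.keys m \<subseteq> - C" by (auto simp: in_keys_iff)
    then show False using that C stable_sets_subset by blast
  qed
  then show "(edge_ideal E :: ('v, 'k) mpoly set) \<subseteq> order_ideal C 1"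
    unfolding edge_ideal_eq order_ideal_def mono_ideal_subset_iff by blast
qed

text \<open>The variables outside \<open>P\<close> form a stable set: the product of two adjacent
  variables lies in \<open>P\<close>, hence so does one of them.\<close>

lemma prime_ideal_over_edge_ideal:
  fixes P :: "('v, 'k::idom) mpoly set"
  assumes "prime_ideal P" "edge_ideal E \<subseteq> P"
  shows "\<exists>S\<in>stable_sets E. order_ideal (- S) 1 \<subseteq> P"
proof -
  let ?S = "{i. Var i \<notin> P}"
  have "?S \<in> stable_sets E"
  proof -
    have "\<not> e \<subseteq> ?S" if e: "e \<in> E" for e
    proof -
      obtain i j where ij: "e = {i, j}" using edge_obtain[OF e] by blast
      have "Var i * Var j \<in> (edge_ideal E :: ('v, 'k) mpoly set)"
        unfolding edge_ideal_def using e ij by (intro ideal.span_base) blast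
      then have "Var i * Var j \<in> P" using assms(2) by blast
      then have "Var i \<in> P \<or> Var j \<in> P" using assms(1) by (simp add: prime_ideal_def)
      then show ?thesis using ij by auto
    qed
    then show ?thesis by (simp add: stable_sets_def)
  qed
  moreover have "order_ideal (- ?S) 1 \<subseteq> P"
    using assms(1) by (intro order_ideal_1_subset) (auto simp: prime_ideal_def)
  ultimately show ?thesis by blast
qed

lemma minimal_primes_edge_ideal:
  "minimal_primes (edge_ideal E :: ('v, 'k::idom) mpoly set) =
    (\<lambda>S. order_ideal (- S) 1) ` max_stable_sets E"
proof (intro set_eqI iffI)
  fix P :: "('v, 'k) mpoly set"
  assume P: "P \<in> minimal_primes (edge_ideal E)"
  then obtain S where S: "S \<in> stable_sets E" "order_ideal (- S) 1 \<subseteq> P"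
    using prime_ideal_over_edge_ideal unfolding minimal_primes_def by blast
  obtain S' where S': "S' \<in> max_stable_sets E" "S \<subseteq> S'" using ex_max_stable_set[OF S(1)] by blast
  have "(order_ideal (- S') 1 :: ('v, 'k) mpoly set) \<subseteq> order_ideal (- S) 1"
    using S'(2) unfolding order_ideal_1_subset_iff by blast
  moreover have "edge_ideal E \<subseteq> (order_ideal (- S') 1 :: ('v, 'k) mpoly set)"
    using S'(1) unfolding edge_ideal_subset_order_ideal_iff by (simp add: max_stable_sets_def)
  ultimately have "P = order_ideal (- S') 1"
    using P S(2) prime_ideal_order_ideal unfolding minimal_primes_def by blast
  then show "P \<in> (\<lambda>S. order_ideal (- S) 1) ` max_stable_sets E" using S'(1) by blast
next
  fix P :: "('v, 'k) mpoly set"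
  assume "P \<in> (\<lambda>S. order_ideal (- S) 1) ` max_stable_sets E"
  then obtain S where S: "S \<in> max_stable_sets E" "P = order_ideal (- S) 1" by blast
  have "edge_ideal E \<subseteq> P"
    using S(1) unfolding S(2) edge_ideal_subset_order_ideal_iff by (simp add: max_stable_sets_def)
  moreover have "Q = P" if Q: "prime_ideal Q" "edge_ideal E \<subseteq> Q" "Q \<subseteq> P" for Q
  proof -
    obtain S' where S': "S' \<in> stable_sets E" "order_ideal (- S') 1 \<subseteq> Q"
      using prime_ideal_over_edge_ideal[OF Q(1,2)] by blast
    then have "(order_ideal (- S') 1 :: ('v, 'k) mpoly set) \<subseteq> order_ideal (- S) 1"
      using Q(3) S(2) by blast
    then have "S \<subseteq> S'" unfolding order_ideal_1_subset_iff by blast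
    then have "S' = S" using S(1) S'(1) by (auto simp: max_stable_sets_def)
    then show ?thesis using S'(2) Q(3) S(2) by blast
  qed
  ultimately show "P \<in> minimal_primes (edge_ideal E)"
    unfolding minimal_primes_def using S(2) prime_ideal_order_ideal by blast
qed

lemma ideal_power_subset_order_ideal:
  assumes "S \<in> stable_sets E"
  shows "ideal_power (edge_ideal E :: ('v, 'k::comm_ring_1) mpoly set) r \<subseteq> order_ideal (- S) r"
proof (induction r)
  case 0
  show ?case by (auto simp: order_ideal_def mono_ideal_def)
next
  case (Suc r)
  have "f * g \<in> order_ideal (- S) (Suc r)"
    if "f \<in> edge_ideal E" "g \<in> ideal_power (edge_ideal E) r" for f g :: "('v, 'k) mpoly"
  proof -
    have "f \<in> order_ideal (- S) 1"
      using that(1) assms edge_ideal_subset_order_ideal_iff[of "- S"] by auto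
    then show ?thesis using order_ideal_mult[of f "- S" 1 g r] that(2) Suc by auto
  qed
  then show ?case
    unfolding ideal_power.simps ideal_prod_def
    by (intro ideal.span_minimal is_ideal_order_ideal) blast
qed

text \<open>
  Locally at the minimal prime of a maximal stable set \<open>S\<close>, the variables of \<open>S\<close> are units, and each
  other variable has a neighbour in \<open>S\<close>, so it lies in the edge ideal.
\<close>

lemma mono_in_ideal_power:
  assumes "S \<in> max_stable_sets E" "r \<le> cdeg (- S) m"
  shows "mon ((\<Sum>i\<in>S. Poly_Mapping.single i r) + m) \<in> ideal_power (edge_ideal E :: ('v, 'k::comm_ring_1) mpoly set) r"
  using assms(2)
proof (induction r arbitrary: m)
  case 0
  then show ?case by simp
next
  case (Suc r)
  then have "cdeg (- S) m \<noteq> 0" by linarith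
  then obtain j where j: "j \<notin> S" "mexp m j \<noteq> 0" by (metis sum.neutral ComplD)
  have "insert j S \<notin> stable_sets E"
    using assms(1) j(1) unfolding max_stable_sets_def by blast
  then obtain e where e: "e \<in> E" "e \<subseteq> insert j S" by (auto simp: stable_sets_def)
  have "\<not> e \<subseteq> S" using assms(1) e(1) by (auto simp: max_stable_sets_def stable_sets_def)
  then have "j \<in> e" using e(2) by blast
  obtain x y where "e = {x, y}" "x \<noteq> y" using edge_obtain[OF e(1)] .
  then obtain i where i: "e = {i, j}" "i \<noteq> j" using \<open>j \<in> e\<close> by auto
  then have "i \<in> S" using e(2) by blast
  let ?m1 = "m - Poly_Mapping.single j 1"
  let ?S = "\<lambda>A r. \<Sum>i\<in>A. Poly_Mapping.single i (r :: nat)"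
  have m: "m = ?m1 + Poly_Mapping.single j 1"
    using j(2) by (intro poly_mapping_eqI) (auto simp: lookup_add lookup_minus lookup_single when_def)
  have "cdeg (- S) m = cdeg (- S) ?m1 + 1"
    using j(1) by (subst m) (simp add: cdeg_add lookup_single when_def)
  then have "r \<le> cdeg (- S) ?m1" using Suc.prems by linarith
  from Suc.IH[OF this] have "mon (?S S r + ?m1) \<in> ideal_power (edge_ideal E :: ('v, 'k) mpoly set) r" .
  \<comment> \<open>Besides the edge \<open>{i, j}\<close>, this factor takes one copy of every
    other variable of \<open>S\<close>, so that the exponents on \<open>S\<close> drop evenly from
    \<open>Suc r\<close> to \<open>r\<close>.\<close>
  moreover have "mon (?S (S - {i}) 1 + (Poly_Mapping.single i 1 + Poly_Mapping.single j 1)) \<in>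
      (edge_ideal E :: ('v, 'k) mpoly set)"
  proof -
    have "mon (?S (S - {i}) 1) * (Var i * Var j) \<in> (edge_ideal E :: ('v, 'k) mpoly set)"
      unfolding edge_ideal_def using e(1) i(1) by (intro ideal.span_scale ideal.span_base) blast
    then show ?thesis by (simp add: Var_def mult_single)
  qed
  moreover have "?S S (Suc r) + m =
      (?S (S - {i}) 1 + (Poly_Mapping.single i 1 + Poly_Mapping.single j 1)) + (?S S r + ?m1)"
    using \<open>i \<in> S\<close> j i(2) by (intro poly_mapping_eqI)
      (auto simp: lookup_add keys_indicator lookup_minus lookup_single when_def)
  then have "(mon (?S S (Suc r) + m) :: ('v, 'k) mpoly) =
      mon (?S (S - {i}) 1 + (Poly_Mapping.single i 1 + Poly_Mapping.single j 1)) * mon (?S S r + ?m1)"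
    by (simp only: mono_mult)
  ultimately show ?case
    unfolding ideal_power.simps ideal_prod_def by (intro ideal.span_base) blast
qed

text \<open>Cancelling \<open>g\<close> at each minimal prime separately bounds the orders of
  \<open>f\<close>. Conversely, one \<open>g\<close> must serve all minimal primes at once: it is a
  sum with one monomial for each maximal stable set, where every summand avoids its own prime and
  multiplies the symbolic monomials into the ordinary power.\<close>

lemma symbolic_power_edge_ideal:
  assumes "s \<ge> 1"
  shows "symbolic_power (edge_ideal E :: ('v, 'k::idom) mpoly set) s =
    mono_ideal {m. mexp m \<in> symbolic_weights E s}"
proof
  show "symbolic_power (edge_ideal E :: ('v, 'k) mpoly set) s \<subseteq>
      mono_ideal {m. mexp m \<in> symbolic_weights E s}"
  proof
    fix f :: "('v, 'k) mpoly"
    assume "f \<in> symbolic_power (edge_ideal E) s"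
    then obtain g where g: "\<And>S. S \<in> max_stable_sets E \<Longrightarrow> g \<notin> order_ideal (- S) 1"
        "g * f \<in> ideal_power (edge_ideal E) s"
      unfolding symbolic_power_def minimal_primes_edge_ideal by blast
    have "s \<le> cdeg (- S) m" if m: "m \<in> Poly_Mapping.keys f" and S: "S \<in> stable_sets E" for m S
    proof -
      obtain S' where S': "S' \<in> max_stable_sets E" "S \<subseteq> S'" using ex_max_stable_set[OF S] by blast
      then have "S' \<in> stable_sets E" by (simp add: max_stable_sets_def)
      then have "f \<in> order_ideal (- S') s"
        using ideal_power_subset_order_ideal g(2) order_ideal_cancel[OF _ g(1)[OF S'(1)]] by blast
      then have "s \<le> cdeg (- S') m"
        using m by (auto simp: order_ideal_def mono_ideal_def)
      also have "\<dots> \<le> cdeg (- S) m" using S'(2) by (intro sum_mono2) auto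
      finally show ?thesis .
    qed
    then show "f \<in> mono_ideal {m. mexp m \<in> symbolic_weights E s}"
      by (auto simp: mono_ideal_def symbolic_weights_def)
  qed
  define u where "u S = (\<Sum>i\<in>S. Poly_Mapping.single i s)" for S :: "'v set"
  define g :: "('v, 'k) mpoly" where "g = (\<Sum>S\<in>max_stable_sets E. mon (u S))"
  \<comment> \<open>As \<open>s\<close> is positive, \<open>u S\<close> determines \<open>S\<close>.
    So the summands of \<open>g\<close> are distinct monomials and cannot cancel in any
    characteristic.\<close>
  have keys_u: "Poly_Mapping.keys (u S) = S" for S
    using assms by (auto simp: u_def in_keys_iff keys_indicator split: if_splits)
  have "u S \<in> Poly_Mapping.keys g" if "S \<in> max_stable_sets E" for S
  proof -
    have "mexp g (u S) = (\<Sum>S'\<in>max_stable_sets E. if S' = S then 1 else 0)"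
      unfolding g_def lookup_sum lookup_single when_def using keys_u
      by (intro sum.cong refl) metis
    then show ?thesis using that by (simp add: in_keys_iff)
  qed
  moreover have "cdeg (- S) (u S) = 0" for S
    by (simp add: u_def keys_indicator)
  ultimately have "g \<notin> order_ideal (- S) 1" if "S \<in> max_stable_sets E" for S
    using that unfolding order_ideal_def mono_ideal_def
    by (metis (mono_tags, lifting) mem_Collect_eq not_one_le_zero subsetD)
  then have g: "g \<notin> \<Union> (minimal_primes (edge_ideal E))"
    unfolding minimal_primes_edge_ideal by blast
  \<comment> \<open>The \<open>f\<close> with \<open>g * f\<close> in the power form an ideal, so it
    is enough to treat monomials.\<close>
  have "mono_ideal {m. mexp m \<in> symbolic_weights E s} \<subseteq> {f. g * f \<in> ideal_power (edge_ideal E) s}"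
  proof (rule mono_ideal_subset[OF is_ideal_colon[OF is_ideal_ideal_power]], safe)
    fix m :: "'v \<Rightarrow>\<^sub>0 nat" assume m: "mexp m \<in> symbolic_weights E s"
    have "mon (u S + m) \<in> ideal_power (edge_ideal E :: ('v, 'k) mpoly set) s"
      if "S \<in> max_stable_sets E" for S
      unfolding u_def using m that
      by (intro mono_in_ideal_power) (auto simp: symbolic_weights_def max_stable_sets_def)
    then have "(\<Sum>S\<in>max_stable_sets E. mon (u S + m)) \<in> ideal_power (edge_ideal E :: ('v, 'k) mpoly set) s"
      by (intro ideal.subspace_sum is_ideal_ideal_power)
    then show "g * mon m \<in> ideal_power (edge_ideal E) s"
      by (simp add: g_def sum_distrib_right mono_mult)
  qed
  then show "mono_ideal {m. mexp m \<in> symbolic_weights E s} \<subseteq> symbolic_power (edge_ideal E :: ('v, 'k) mpoly set) s"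
    unfolding symbolic_power_def using g by blast
qed

end

section \<open>Joins and secant ideals\<close>

text \<open>The Stanley-Reisner ideal of the simplicial complex \<open>\<Delta>\<close>.\<close>

definition face_ideal :: "'v set set \<Rightarrow> ('v, 'k::comm_ring_1) mpoly set"
  where "face_ideal \<Delta> = mono_ideal {m. Poly_Mapping.keys m \<notin> \<Delta>}"

definition down_closed :: "'v set set \<Rightarrow> bool"
  where "down_closed \<Delta> \<longleftrightarrow> (\<forall>\<sigma>\<in>\<Delta>. \<forall>\<tau>\<subseteq>\<sigma>. \<tau> \<in> \<Delta>)"

text \<open>Both complexes live on the same vertices and the two faces may overlap, unlike in the
  topological join.\<close>

definition join_complex :: "'v set set \<Rightarrow> 'v set set \<Rightarrow> 'v set set"
  where "join_complex \<Delta> \<Gamma> = {\<sigma> \<union> \<tau> |\<sigma> \<tau>. \<sigma> \<in> \<Delta> \<and> \<tau> \<in> \<Gamma>}"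

lemma keys_add_nat: "Poly_Mapping.keys (a + b :: 'v \<Rightarrow>\<^sub>0 nat) = Poly_Mapping.keys a \<union> Poly_Mapping.keys b"
  by (auto simp: in_keys_iff lookup_add)

lemma monomial_induct [case_names 0 add]:
  fixes m :: "'v::finite \<Rightarrow>\<^sub>0 nat"
  assumes "P 0" "\<And>i m. P m \<Longrightarrow> P (Poly_Mapping.single i 1 + m)"
  shows "P m"
proof (induction "sum (mexp m) UNIV" arbitrary: m)
  case 0
  then have "m = 0" by (intro poly_mapping_eqI) simp
  then show ?case using assms(1) by simp
next
  case (Suc n)
  then have "sum (mexp m) UNIV \<noteq> 0" by linarith
  then obtain i where i: "mexp m i \<noteq> 0" by (metis sum.neutral)
  let ?m = "m - Poly_Mapping.single i 1"
  have m: "m = Poly_Mapping.single i 1 + ?m"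
    using i by (intro poly_mapping_eqI) (auto simp: lookup_add lookup_minus lookup_single when_def)
  have "sum (mexp m) UNIV = 1 + sum (mexp ?m) UNIV"
    by (subst m) (simp add: lookup_add sum.distrib lookup_single when_def)
  then have "n = sum (mexp ?m) UNIV" using Suc(2) by linarith
  then have "P ?m" by (rule Suc(1))
  then show ?case using assms(2) m by metis
qed

lemma rename_mono: "rename f (mon m) = mono_subst (\<lambda>i. Var (f i)) m"
  by (simp add: rename_eq_subst subst_single)

definition restrict_vars :: "'v set \<Rightarrow> 'v \<Rightarrow> ('v, 'k::comm_ring_1) mpoly"
  where "restrict_vars U i = (if i \<in> U then Var i else 0)"

lemma mono_subst_restrict_vars:
  "mono_subst (restrict_vars U) m =
    (if Poly_Mapping.keys m \<subseteq> U then mon m else 0 :: ('v, 'k::comm_ring_1) mpoly)"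
proof (cases "Poly_Mapping.keys m \<subseteq> U")
  case True
  then have "mono_subst (restrict_vars U) m = (mono_subst Var m :: ('v, 'k) mpoly)"
    unfolding mono_subst_def by (intro prod.cong) (auto simp: restrict_vars_def)
  then show ?thesis using True by (simp add: mono_subst_Var)
next
  case False
  then obtain i where i: "i \<in> Poly_Mapping.keys m" "i \<notin> U" by blast
  then have "restrict_vars U i ^ mexp m i = (0 :: ('v, 'k) mpoly)"
    by (simp add: restrict_vars_def in_keys_iff zero_power)
  then have "mono_subst (restrict_vars U) m = (0 :: ('v, 'k) mpoly)"
    unfolding mono_subst_def using i(1) by (intro prod_zero) auto
  then show ?thesis using False by simp
qed

text \<open>Each monomial is either kept or killed, so the surviving terms cannot cancel.\<close>

lemma subst_restrict_vars_eq_0_iff: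
  "subst (restrict_vars U) p = 0 \<longleftrightarrow> (\<forall>m\<in>Poly_Mapping.keys p. \<not> Poly_Mapping.keys m \<subseteq> U)"
proof
  assume 0: "subst (restrict_vars U) p = 0"
  show "\<forall>m\<in>Poly_Mapping.keys p. \<not> Poly_Mapping.keys m \<subseteq> U"
  proof (intro ballI notI)
    fix m assume m: "m \<in> Poly_Mapping.keys p" "Poly_Mapping.keys m \<subseteq> U"
    have "mexp (Const (mexp p m') * mono_subst (restrict_vars U) m') m = (if m' = m then mexp p m else 0)" for m'
      using m(2) by (simp add: mono_subst_restrict_vars Const_def mult_single lookup_single when_def)
    then have "mexp (subst (restrict_vars U) p) m = mexp p m"
      using m(1) by (simp add: subst_def lookup_sum)
    then show False using 0 m(1) by (simp add: in_keys_iff)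
  qed
next
  assume "\<forall>m\<in>Poly_Mapping.keys p. \<not> Poly_Mapping.keys m \<subseteq> U"
  then show "subst (restrict_vars U) p = 0"
    unfolding subst_def by (intro sum.neutral ballI) (simp add: mono_subst_restrict_vars)
qed

lemma subst_restrict_vars_face_ideal:
  assumes "p \<in> face_ideal \<Delta>" "down_closed \<Delta>" "\<sigma> \<in> \<Delta>" "U \<subseteq> \<sigma>"
  shows "subst (restrict_vars U) p = 0"
proof -
  have "\<not> Poly_Mapping.keys m \<subseteq> U" if "m \<in> Poly_Mapping.keys p" for m
  proof
    assume "Poly_Mapping.keys m \<subseteq> U"
    then have "Poly_Mapping.keys m \<in> \<Delta>" using assms(2-4) unfolding down_closed_def by blast
    moreover have "Poly_Mapping.keys m \<notin> \<Delta>"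
      using that assms(1) unfolding face_ideal_def mono_ideal_def by blast
    ultimately show False by blast
  qed
  then show ?thesis by (simp add: subst_restrict_vars_eq_0_iff)
qed

abbreviation linear_relations :: "('v xyz, 'k::comm_ring_1) mpoly set"
  where "linear_relations \<equiv> {Var (X i) - Var (Y i) - Var (Z i) |i. True}"

text \<open>
  One inclusion specialises \<open>y\<close> to the coordinate subspace of a face \<open>\<sigma>\<close> and \<open>z\<close> to that of
  \<open>\<tau> - \<sigma>\<close>; the other rewrites each \<open>x\<^sub>i\<close> in a monomial as \<open>y\<^sub>i + z\<^sub>i\<close>.
\<close>

lemma join_ideal_face_ideal:
  fixes \<Delta> \<Gamma> :: "'v::finite set set"
  assumes \<Delta>: "down_closed \<Delta>" and \<Gamma>: "down_closed \<Gamma>"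
  shows "join_ideal (face_ideal \<Delta>) (face_ideal \<Gamma>) =
    (face_ideal (join_complex \<Delta> \<Gamma>) :: ('v, 'k::comm_ring_1) mpoly set)"
proof -
  define A where "A = ideal_gen (rename Y ` (face_ideal \<Delta> :: ('v, 'k) mpoly set))"
  define B where "B = ideal_gen (rename Z ` (face_ideal \<Gamma> :: ('v, 'k) mpoly set))"
  define C where "C = ideal_gen (linear_relations :: ('v xyz, 'k) mpoly set)"
  have ABC: "is_ideal A" "is_ideal B" "is_ideal C"
    by (simp_all add: A_def B_def C_def)
  then have L: "is_ideal (A + B + C)" by (intro is_ideal_plus)
  have join: "join_ideal (face_ideal \<Delta>) (face_ideal \<Gamma>) = {p. rename X p \<in> A + B + C}"
    by (simp add: join_ideal_def A_def B_def C_def)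
  have mem: "f \<in> A + B + C" if "f \<in> A \<or> f \<in> B \<or> f \<in> C" for f
  proof -
    have 0: "0 \<in> A" "0 \<in> B" "0 \<in> C" using ABC by (simp_all add: ideal.subspace_0)
    then have "f + 0 + 0 \<in> A + B + C \<or> 0 + f + 0 \<in> A + B + C \<or> 0 + 0 + f \<in> A + B + C"
      using that by blast
    then show ?thesis by simp
  qed
  show ?thesis
  proof
    show "join_ideal (face_ideal \<Delta>) (face_ideal \<Gamma>) \<subseteq> (face_ideal (join_complex \<Delta> \<Gamma>) :: ('v, 'k) mpoly set)"
    proof
      fix p :: "('v, 'k) mpoly"
      assume "p \<in> join_ideal (face_ideal \<Delta>) (face_ideal \<Gamma>)"
      then have p: "rename X p \<in> A + B + C" by (simp add: join)
      have "\<not> Poly_Mapping.keys m \<subseteq> \<sigma> \<union> \<tau>"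
        if "\<sigma> \<in> \<Delta>" "\<tau> \<in> \<Gamma>" "m \<in> Poly_Mapping.keys p" for \<sigma> \<tau> m
      proof -
        \<comment> \<open>With \<open>\<tau>\<close> in place of \<open>\<tau> - \<sigma>\<close>,
          both \<open>Y i\<close> and \<open>Z i\<close> would go to \<open>Var i\<close> on the
          overlap, and their sum would differ from the image of \<open>X i\<close>. The difference
          makes all linear relations vanish.\<close>
        define h :: "'v xyz \<Rightarrow> ('v, 'k) mpoly" where
          "h v = (case v of X i \<Rightarrow> restrict_vars (\<sigma> \<union> \<tau>) i
            | Y i \<Rightarrow> restrict_vars \<sigma> i | Z i \<Rightarrow> restrict_vars (\<tau> - \<sigma>) i)" for v
        have ker: "is_ideal {q. subst h q = 0}"
          using is_ideal_subst_vimage[of "{0}" h] by simp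
        have "A \<subseteq> {q. subst h q = 0}"
          unfolding A_def using that(1) \<Delta>
          by (intro ideal.span_minimal ker)
            (auto simp: subst_rename h_def intro: subst_restrict_vars_face_ideal)
        moreover have "B \<subseteq> {q. subst h q = 0}"
          unfolding B_def using that(2) \<Gamma>
          by (intro ideal.span_minimal ker)
            (auto simp: subst_rename h_def intro: subst_restrict_vars_face_ideal)
        moreover have "C \<subseteq> {q. subst h q = 0}"
          unfolding C_def
          by (intro ideal.span_minimal ker)
            (auto simp: subst_diff subst_Var h_def restrict_vars_def)
        moreover obtain a b c where "rename X p = a + b + c" "a \<in> A" "b \<in> B" "c \<in> C"
          using p by (auto elim!: set_plus_elim)
        ultimately have "subst h a = 0" "subst h b = 0" "subst h c = 0"
          "subst h (rename X p) = subst h a + subst h b + subst h c"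
          by (auto simp: subst_add)
        then have "subst h (rename X p) = 0" by simp
        then have "subst (restrict_vars (\<sigma> \<union> \<tau>)) p = 0"
          by (simp add: subst_rename h_def)
        then show ?thesis using that(3) unfolding subst_restrict_vars_eq_0_iff by blast
      qed
      then have "Poly_Mapping.keys m \<notin> join_complex \<Delta> \<Gamma>" if "m \<in> Poly_Mapping.keys p" for m
        using that unfolding join_complex_def by blast
      then show "p \<in> face_ideal (join_complex \<Delta> \<Gamma>)"
        by (auto simp: face_ideal_def mono_ideal_def)
    qed
    show "(face_ideal (join_complex \<Delta> \<Gamma>) :: ('v, 'k) mpoly set) \<subseteq> join_ideal (face_ideal \<Delta>) (face_ideal \<Gamma>)"
      unfolding join face_ideal_def[of "join_complex \<Delta> \<Gamma>"]
    proof (rule mono_ideal_subset)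
      show "is_ideal {p. rename X p \<in> A + B + C}"
        unfolding rename_eq_subst by (rule is_ideal_subst_vimage[OF L])
      define y :: "('v \<Rightarrow>\<^sub>0 nat) \<Rightarrow> ('v xyz, 'k) mpoly" where "y = mono_subst (\<lambda>i. Var (Y i))"
      define z :: "('v \<Rightarrow>\<^sub>0 nat) \<Rightarrow> ('v xyz, 'k) mpoly" where "z = mono_subst (\<lambda>i. Var (Z i))"
      define x :: "('v \<Rightarrow>\<^sub>0 nat) \<Rightarrow> ('v xyz, 'k) mpoly" where "x = mono_subst (\<lambda>i. Var (X i))"
      have y_mem: "y a \<in> A" if "Poly_Mapping.keys a \<notin> \<Delta>" for a
        unfolding A_def using that
        by (intro ideal.span_base image_eqI[of _ _ "mon a"]) (simp_all add: y_def rename_mono face_ideal_def)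
      have z_mem: "z b \<in> B" if "Poly_Mapping.keys b \<notin> \<Gamma>" for b
        unfolding B_def using that
        by (intro ideal.span_base image_eqI[of _ _ "mon b"]) (simp_all add: z_def rename_mono face_ideal_def)
      \<comment> \<open>The induction passes through partly converted monomials. The hypothesis says
        that however the remaining \<open>x\<close>-variables are shared out between
        \<open>y\<close> and \<open>z\<close>, the \<open>y\<close>-part or the
        \<open>z\<close>-part ends up as a non-face.\<close>
      have key: "y a * z b * x m \<in> A + B + C"
        if "\<And>c d. c + d = m \<Longrightarrow> Poly_Mapping.keys (a + c) \<notin> \<Delta> \<or> Poly_Mapping.keys (b + d) \<notin> \<Gamma>"
        for a b m
        using that
      proof (induction m arbitrary: a b rule: monomial_induct)
        case 0
        from 0[of 0 0] have "y a \<in> A + B + C \<or> z b \<in> A + B + C"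
          using y_mem z_mem mem by auto
        then have "z b * y a \<in> A + B + C \<or> y a * z b \<in> A + B + C"
          using ideal.subspace_scale[OF L] by blast
        then show ?case by (simp add: x_def mult.commute)
      next
        case (add i m)
        let ?e = "Poly_Mapping.single i (1 :: nat)"
        have 1: "y (a + ?e) * z b * x m \<in> A + B + C"
        proof (rule add.IH)
          fix c d assume "c + d = m"
          then have "(?e + c) + d = ?e + m" by (auto simp: add_ac)
          from add.prems[OF this] show "Poly_Mapping.keys (a + ?e + c) \<notin> \<Delta> \<or> Poly_Mapping.keys (b + d) \<notin> \<Gamma>"
            by (simp add: add_ac)
        qed
        have 2: "y a * z (b + ?e) * x m \<in> A + B + C"
        proof (rule add.IH)
          fix c d assume "c + d = m"
          then have "c + (?e + d) = ?e + m" by (auto simp: add_ac)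
          from add.prems[OF this] show "Poly_Mapping.keys (a + c) \<notin> \<Delta> \<or> Poly_Mapping.keys (b + ?e + d) \<notin> \<Gamma>"
            by (simp add: add_ac)
        qed
        have "Var (X i) - Var (Y i) - Var (Z i) \<in> A + B + C"
          by (rule mem) (auto simp: C_def intro: ideal.span_base)
        then have 3: "(y a * z b * x m) * (Var (X i) - Var (Y i) - Var (Z i)) \<in> A + B + C"
          by (rule ideal.subspace_scale[OF L])
        have "y a * z b * x (?e + m) = (y a * z b * x m) * (Var (X i) - Var (Y i) - Var (Z i))
            + y (a + ?e) * z b * x m + y a * z (b + ?e) * x m"
          by (simp add: x_def y_def z_def mono_subst_add mono_subst_single algebra_simps)
        then show ?case
          using 1 2 3 by (simp only: ideal.subspace_add[OF L])
      qed
      fix m :: "'v \<Rightarrow>\<^sub>0 nat"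
      assume m: "m \<in> {m. Poly_Mapping.keys m \<notin> join_complex \<Delta> \<Gamma>}"
      have "y 0 * z 0 * x m \<in> A + B + C"
      proof (rule key)
        fix c d assume "c + d = m"
        then have "Poly_Mapping.keys m = Poly_Mapping.keys c \<union> Poly_Mapping.keys d"
          using keys_add_nat[of c d] by simp
        then show "Poly_Mapping.keys (0 + c) \<notin> \<Delta> \<or> Poly_Mapping.keys (0 + d) \<notin> \<Gamma>"
          using m by (auto simp: join_complex_def)
      qed
      then show "mon m \<in> {p. rename X p \<in> A + B + C}"
        by (simp add: x_def y_def z_def rename_mono)
    qed
  qed
qed

definition coverable_sets :: "'v set set \<Rightarrow> nat \<Rightarrow> 'v set set"
  where "coverable_sets E k = {V. coverable (stable_sets E) k (\<lambda>v. of_bool (v \<in> V))}"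

context
  fixes E :: "'v::finite set set"
  assumes E: "E \<subseteq> [UNIV]\<^bsup>2\<^esup>"
begin

lemma down_closed_stable_sets: "down_closed (stable_sets E)"
  unfolding down_closed_def using stable_sets_subset by blast

lemma down_closed_coverable_sets: "down_closed (coverable_sets E k)"
  unfolding down_closed_def coverable_sets_def by (auto elim!: coverable_antimono)

lemma coverable_sets_1: "coverable_sets E 1 = stable_sets E"
proof (intro set_eqI iffI)
  fix V assume "V \<in> coverable_sets E 1"
  then obtain S where S: "S 0 \<in> stable_sets E" "\<And>v. of_bool (v \<in> V) \<le> (of_bool (v \<in> S 0) :: nat)"
    by (auto simp: coverable_sets_def coverable_def)
  have "V \<subseteq> S 0"
  proof
    fix v assume "v \<in> V"
    then show "v \<in> S 0" using S(2)[of v] by (cases "v \<in> S 0") auto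
  qed
  then show "V \<in> stable_sets E" using S(1) stable_sets_subset by blast
qed (auto simp: coverable_sets_def coverable_of_bool_1[simplified])

lemma coverable_sets_Suc: "coverable_sets E (Suc k) = join_complex (coverable_sets E k) (stable_sets E)"
proof (intro set_eqI iffI)
  fix V assume "V \<in> coverable_sets E (Suc k)"
  then obtain S where S: "\<And>j. j < Suc k \<Longrightarrow> S j \<in> stable_sets E"
      "\<And>v. of_bool (v \<in> V) \<le> (\<Sum>j<Suc k. of_bool (v \<in> S j) :: nat)"
    unfolding coverable_sets_def coverable_def by blast
  have "of_bool (v \<in> V - S k) \<le> (\<Sum>j<k. of_bool (v \<in> S j) :: nat)" for v
    using S(2)[of v] by auto
  then have "V - S k \<in> coverable_sets E k"
    using S(1) less_SucI unfolding coverable_sets_def coverable_def by blast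
  moreover have "V \<inter> S k \<in> stable_sets E"
    using S(1)[of k] stable_sets_subset by (metis Int_lower2 lessI)
  moreover have "V = (V - S k) \<union> (V \<inter> S k)" by blast
  ultimately show "V \<in> join_complex (coverable_sets E k) (stable_sets E)"
    unfolding join_complex_def by blast
next
  fix V assume "V \<in> join_complex (coverable_sets E k) (stable_sets E)"
  then obtain A B where AB: "V = A \<union> B" "A \<in> coverable_sets E k" "B \<in> stable_sets E"
    unfolding join_complex_def by blast
  have "coverable (stable_sets E) (Suc k) (\<lambda>v. of_bool (v \<in> V))"
    by (rule coverable_Suc[OF _ AB(3), of _ "\<lambda>v. of_bool (v \<in> A)"])
      (use AB in \<open>auto simp: coverable_sets_def\<close>)
  then show "V \<in> coverable_sets E (Suc k)" by (simp add: coverable_sets_def)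
qed

text \<open>Each further join with the edge ideal allows one more colour class; the index
  \<open>Suc n\<close> belongs to \<open>n\<close> joins.\<close>

lemma secant_ideal_edge_ideal:
  assumes "edge_ideal E = (face_ideal (stable_sets E) :: ('v, 'k::comm_ring_1) mpoly set)"
  shows "secant_ideal (edge_ideal E) (Suc n) = (face_ideal (coverable_sets E (Suc n)) :: ('v, 'k) mpoly set)"
proof (induction n)
  case 0
  then show ?case using assms coverable_sets_1 by (simp add: secant_ideal_def)
next
  case (Suc n)
  have "secant_ideal (edge_ideal E :: ('v, 'k) mpoly set) (Suc (Suc n)) =
      join_ideal (secant_ideal (edge_ideal E) (Suc n)) (edge_ideal E)"
    by (simp add: secant_ideal_def)
  also have "\<dots> = join_ideal (face_ideal (coverable_sets E (Suc n))) (face_ideal (stable_sets E))"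
    by (simp only: Suc) (simp only: assms)
  finally show ?case
    by (simp only: coverable_sets_Suc[of "Suc n"]
        join_ideal_face_ideal[OF down_closed_coverable_sets down_closed_stable_sets])
qed

end

section \<open>From identities of ideals to identities of exponent sets\<close>

lemma up_closed_symbolic_weights: "up_closed {m. mexp m \<in> symbolic_weights E s}"
  by (auto simp: up_closed_def symbolic_weights_def cdeg_add intro: trans_le_add2)

lemma up_closed_secant_weights:
  assumes "E \<subseteq> [UNIV :: 'v::finite set]\<^bsup>2\<^esup>"
  shows "up_closed {m. mexp m \<in> secant_weights E s}"
  unfolding up_closed_def
  by (auto simp: lookup_add intro: secant_weights_mono[OF assms])

lemma secant_ideal_eq:
  fixes E :: "'v::finite set set"
  assumes "E \<subseteq> [UNIV]\<^bsup>2\<^esup>" "s \<ge> 1"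
  shows "secant_ideal (edge_ideal E :: ('v, 'k::comm_ring_1) mpoly set) s =
    mono_ideal {m. mexp m \<in> secant_weights E s}"
proof -
  have "edge_ideal E = (face_ideal (stable_sets E) :: ('v, 'k) mpoly set)"
    by (simp add: edge_ideal_eq[OF assms(1)] face_ideal_def)
  from secant_ideal_edge_ideal[OF assms(1) this, of "s - 1"] show ?thesis
    using assms(2) by (simp add: face_ideal_def coverable_sets_def secant_weights_def in_keys_iff)
qed

lemma up_closed_sum:
  "up_closed A \<Longrightarrow> up_closed {a + b |a b. a \<in> A \<and> b \<in> B}"
  by (fastforce simp: up_closed_def add.assoc[symmetric])

text \<open>On a finite type every function is the exponent vector of a monomial, so a decomposition
  of functions lifts to one of monomials.\<close>

lemma lookup_image_sum:
  fixes A B :: "('v::finite \<Rightarrow> nat) set"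
  shows "m \<in> {a + b |a b. mexp a \<in> A \<and> mexp b \<in> B} \<longleftrightarrow>
    mexp m \<in> {\<lambda>v. a v + b v |a b. a \<in> A \<and> b \<in> B}"
proof
  assume "mexp m \<in> {\<lambda>v. a v + b v |a b. a \<in> A \<and> b \<in> B}"
  then obtain a b where ab: "mexp m = (\<lambda>v. a v + b v)" "a \<in> A" "b \<in> B" by blast
  have *: "mexp (Abs_poly_mapping f) = f" for f :: "'v \<Rightarrow> nat" by simp
  have "m = Abs_poly_mapping a + Abs_poly_mapping b"
    using ab(1) by (intro poly_mapping_eqI) (simp add: lookup_add)
  then show "m \<in> {a + b |a b. mexp a \<in> A \<and> mexp b \<in> B}"
    using ab(2,3) * by (intro CollectI exI[of _ "Abs_poly_mapping a"] exI[of _ "Abs_poly_mapping b"]) simp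
qed (force simp: lookup_add fun_eq_iff)

lemma weights_eq_iff:
  fixes A B :: "('v::finite \<Rightarrow> nat) set"
  shows "{m. mexp m \<in> A} = {m. mexp m \<in> B} \<longleftrightarrow> A = B"
proof
  assume eq: "{m. mexp m \<in> A} = {m. mexp m \<in> B}"
  have "f \<in> A \<longleftrightarrow> f \<in> B" for f
  proof -
    have "mexp (Abs_poly_mapping f) = f" by simp
    then show ?thesis using eq by (metis mem_Collect_eq)
  qed
  then show "A = B" by blast
qed simp

text \<open>For monomial ideals with upward closed exponent sets, sums become unions and products
  become sums of exponent vectors, so the ideal identity can be translated for each \<open>s\<close>
  separately.\<close>

lemma symbolic_power_recursion_iff:
  fixes E :: "'v::finite set set" and I :: "('v, 'k::idom) mpoly set"
  assumes E: "E \<subseteq> [UNIV]\<^bsup>2\<^esup>" and I: "I = edge_ideal E" and s: "s \<ge> 1"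
  shows "symbolic_power I s = secant_ideal I s +
      (\<Sum>i=1..s - 1. ideal_prod (symbolic_power I i) (symbolic_power I (s - i))) \<longleftrightarrow>
    symbolic_weights E s = secant_weights E s \<union> (\<Union>i\<in>{1..s - 1}.
      {\<lambda>v. a v + b v |a b. a \<in> symbolic_weights E i \<and> b \<in> symbolic_weights E (s - i)})"
    (is "_ = _ + ?R \<longleftrightarrow> _ = _ \<union> ?D")
proof -
  let ?M = "\<lambda>i. {m :: 'v \<Rightarrow>\<^sub>0 nat. mexp m \<in> symbolic_weights E i}"
  let ?P = "\<lambda>i. {a + b |a b. a \<in> ?M i \<and> b \<in> ?M (s - i)}"
  have up: "up_closed (?P i)" for i
    by (rule up_closed_sum[OF up_closed_symbolic_weights])
  have "?R = (\<Sum>i=1..s - 1. mono_ideal (?P i))"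
  proof (rule sum.cong[OF refl])
    fix i assume "i \<in> {1..s - 1}"
    \<comment> \<open>The range of summation keeps both orders positive, as the description of
      symbolic powers requires.\<close>
    then have "i \<ge> 1" "s - i \<ge> 1" by auto
    then show "ideal_prod (symbolic_power I i) (symbolic_power I (s - i)) = mono_ideal (?P i)"
      unfolding I by (simp only: symbolic_power_edge_ideal[OF E] mono_ideal_prod[OF up_closed_symbolic_weights])
  qed
  also have "\<dots> = mono_ideal (\<Union>i\<in>{1..s - 1}. ?P i)"
    by (rule mono_ideal_sum) (simp_all only: up finite_atLeastAtMost)
  finally have "secant_ideal I s + ?R =
      mono_ideal ({m. mexp m \<in> secant_weights E s} \<union> (\<Union>i\<in>{1..s - 1}. ?P i))"
    unfolding I by (simp only: secant_ideal_eq[OF E s] mono_ideal_plus up_closed_secant_weights[OF E] up_closed_UN up)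
  also have "{m. mexp m \<in> secant_weights E s} \<union> (\<Union>i\<in>{1..s - 1}. ?P i) =
      {m. mexp m \<in> secant_weights E s \<union> ?D}"
  proof -
    have "?P i = {m. mexp m \<in> {\<lambda>v. a v + b v |a b. a \<in> symbolic_weights E i \<and> b \<in> symbolic_weights E (s - i)}}"
      for i
      using lookup_image_sum[of _ "symbolic_weights E i" "symbolic_weights E (s - i)"]
      by (intro set_eqI) (simp only: mem_Collect_eq)
    moreover have "{m. mexp m \<in> A} \<union> (\<Union>i\<in>N. {m. mexp m \<in> B i}) = {m. mexp m \<in> A \<union> (\<Union>i\<in>N. B i)}"
      for A N and B :: "nat \<Rightarrow> ('v \<Rightarrow> nat) set"
      by blast
    ultimately show ?thesis by (simp only:)
  qed
  finally show ?thesis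
    unfolding I symbolic_power_edge_ideal[OF E s] by (simp only: mono_ideal_eq_iff weights_eq_iff)
qed

theorem theorem3p2:
  fixes E :: "'n::finite set set"
    and I :: "('n, 'k::alg_closed_field) mpoly set"
  assumes "E \<subseteq> [UNIV]\<^bsup>2\<^esup>"
    and "I = edge_ideal E"
  shows "(differentially_perfect 1 I \<longleftrightarrow> perfect_graph UNIV E) \<and>
    (perfect_graph UNIV E \<longleftrightarrow>
      (\<forall>s\<ge>1. symbolic_power I s =
         secant_ideal I s +
         (\<Sum>i=1..s - 1. ideal_prod (symbolic_power I i) (symbolic_power I (s - i)))))"
proof -
  let ?rec = "\<forall>s\<ge>1. symbolic_power I s = secant_ideal I s +
    (\<Sum>i=1..s - 1. ideal_prod (symbolic_power I i) (symbolic_power I (s - i)))"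
  have "?rec \<longleftrightarrow> perfect_graph UNIV E"
    unfolding perfect_graph_iff_weights[OF assms(1)]
    using symbolic_power_recursion_iff[OF assms] by simp
  \<comment> \<open>For \<open>r = 1\<close> no join is formed, so the secant ideal is
    \<open>I\<close> itself, and \<open>r + s - 1\<close> reduces to \<open>s\<close>.\<close>
  moreover have "differentially_perfect 1 I \<longleftrightarrow> ?rec"
    by (simp add: differentially_perfect_def secant_ideal_def)
  ultimately show ?thesis by blast
qed

end
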